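(* Let $(X,T)$ be a dynamical system that is distal but not equicontinuous. Then $SE_n^e(X,T)\neq\emptyset$ for every $n\ge 2$. Consequently $\sup_A h^A_{top}(T)=\infty$, the supremum over all increasing sequences $A\subseteq\mathbb{Z}_+$.
   Context: A dynamical system $(X,T)$ is a compact metric space $(X,d)$ with a continuous map $T:X\to X$. A pair $(x,y)$ is proximal if $\inf_{n\ge1}d(T^nx,T^ny)=0$; $(X,T)$ is distal if the only proximal pairs are $(x,x)$. $(X,T)$ is equicontinuous if $\{T^n:n\ge0\}$ is an equicontinuous family. For an increasing sequence $A=\{0\le t_1<t_2<\cdots\}\subseteq\mathbb{Z}_+$ and a finite open cover $\mathcal U$, $h^A_{top}(T,\mathcal U)=\limsup_{n\to\infty}\frac1n\log N(\bigvee_{i=1}^nT^{-t_i}\mathcal U)$, where $N(\cdot)$ is the minimal cardinality of a subcover, and $h^A_{top}(T)=\sup_{\mathcal U}h^A_{top}(T,\mathcal U)$. For $(x_i)_{i=1}^n\in X^n$, a finite cover $\mathcal U=\{U_1,\dots,U_k\}$ is admissible with respect to $(x_i)$ if for each $j$ there is $i_j$ with $x_{i_j}\notin\overline{U_j}$. An $n$-tuple $(x_i)_{i=1}^n$ ($n\ge2$) is a sequence entropy $n$-tuple if $x_i\ne x_j$ for some $i,j$ and for every admissible open cover $\mathcal U$ with respect to $(x_i)$ there is an increasing sequence $A$ with $h^A_{top}(T,\mathcal U)>0$. $SE_n^e(X,T)$ is the set of sequence entropy $n$-tuples with pairwise distinct coordinates. *)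

theory Defs
  imports "HOL-Analysis.Analysis"
begin

definition dyn_system :: "'a::metric_space set \<Rightarrow> ('a \<Rightarrow> 'a) \<Rightarrow> bool" where
  "dyn_system X T \<longleftrightarrow> compact X \<and> continuous_on X T \<and> T ` X \<subseteq> X"

definition proximal :: "'a::metric_space set \<Rightarrow> ('a \<Rightarrow> 'a) \<Rightarrow> 'a \<Rightarrow> 'a \<Rightarrow> bool" where
  "proximal X T x y \<longleftrightarrow> Inf {dist ((T ^^ n) x) ((T ^^ n) y) | n. n \<ge> 1} = 0"

definition distal :: "'a::metric_space set \<Rightarrow> ('a \<Rightarrow> 'a) \<Rightarrow> bool" where
  "distal X T \<longleftrightarrow> (\<forall>x\<in>X. \<forall>y\<in>X. proximal X T x y \<longrightarrow> x = y)"

definition equicontinuous :: "'a::metric_space set \<Rightarrow> ('a \<Rightarrow> 'a) \<Rightarrow> bool" where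
  "equicontinuous X T \<longleftrightarrow> (\<forall>e>0. \<forall>x\<in>X. \<exists>d>0. \<forall>y\<in>X. dist x y < d \<longrightarrow>
      (\<forall>n. dist ((T ^^ n) x) ((T ^^ n) y) < e))"

definition open_cover :: "'a::metric_space set \<Rightarrow> 'a set set \<Rightarrow> bool" where
  "open_cover X \<U> \<longleftrightarrow> finite \<U> \<and> (\<forall>U\<in>\<U>. openin (top_of_set X) U) \<and> X \<subseteq> \<Union>\<U>"

definition Ncov :: "'a set \<Rightarrow> 'a set set \<Rightarrow> nat" where
  "Ncov X \<V> = (LEAST k. \<exists>\<W>\<subseteq>\<V>. X \<subseteq> \<Union>\<W> \<and> card \<W> = k)"

text \<open>The join of T^{-t_1} U, ..., T^{-t_n} U, where the sequence is A 0 < A 1 < ...\<close>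
definition join_cover :: "'a set \<Rightarrow> ('a \<Rightarrow> 'a) \<Rightarrow> (nat \<Rightarrow> nat) \<Rightarrow> 'a set set \<Rightarrow> nat \<Rightarrow> 'a set set" where
  "join_cover X T A \<U> n =
     {X \<inter> (\<Inter>i<n. (T ^^ A i) -` f i) | f. \<forall>i<n. f i \<in> \<U>}"

definition seq_entropy_cover :: "'a set \<Rightarrow> ('a \<Rightarrow> 'a) \<Rightarrow> (nat \<Rightarrow> nat) \<Rightarrow> 'a set set \<Rightarrow> ereal" where
  "seq_entropy_cover X T A \<U> =
     limsup (\<lambda>n. ereal (ln (real (Ncov X (join_cover X T A \<U> n))) / real n))"

definition seq_entropy :: "'a::metric_space set \<Rightarrow> ('a \<Rightarrow> 'a) \<Rightarrow> (nat \<Rightarrow> nat) \<Rightarrow> ereal" where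
  "seq_entropy X T A = (SUP \<U>\<in>{\<U>. open_cover X \<U>}. seq_entropy_cover X T A \<U>)"

definition admissible :: "'a::metric_space set \<Rightarrow> 'a set set \<Rightarrow> 'a list \<Rightarrow> bool" where
  "admissible X \<U> xs \<longleftrightarrow> (\<forall>U\<in>\<U>. \<exists>i<length xs. xs ! i \<notin> closure U)"

definition seq_entropy_tuple :: "'a::metric_space set \<Rightarrow> ('a \<Rightarrow> 'a) \<Rightarrow> 'a list \<Rightarrow> bool" where
  "seq_entropy_tuple X T xs \<longleftrightarrow> length xs \<ge> 2 \<and> set xs \<subseteq> X \<and>
     (\<exists>i<length xs. \<exists>j<length xs. xs ! i \<noteq> xs ! j) \<and>
     (\<forall>\<U>. open_cover X \<U> \<and> admissible X \<U> xs \<longrightarrow>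
        (\<exists>A. strict_mono A \<and> seq_entropy_cover X T A \<U> > 0))"

definition SE_e :: "'a::metric_space set \<Rightarrow> ('a \<Rightarrow> 'a) \<Rightarrow> nat \<Rightarrow> 'a list set" where
  "SE_e X T n = {xs. length xs = n \<and> distinct xs \<and> seq_entropy_tuple X T xs}"

end

(* Let u_m -> x witness the failure of equicontinuity at x = u_0, and let E be the Ellis semigroup.
   Distality makes every element of E left invertible in E and keeps distinct points apart
   under all of E.  Along an ultrafilter, let the fibre over q in E consist of the points z
   such that T^t u_m is near z, for almost all m, at times t at which T^t u_i is near q u_i for
   finitely many prescribed i; it plays the role of the limit of the graphs of the coordinate
   maps on the orbit closure of (u_i).
   Stopping each pair (u_m, x) when it first becomes eta-separated puts distinct points at
   distance at most eta into some fibre.  All fibres being images of each other under E, a finite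
   fibre would have a uniform separation, so the fibre over the identity is infinite.
   Given a finite cover by small balls, a set of times with a minimal pattern of balls met by the
   fibres stays good under refinement, so one can choose points u_m one by one that realise all
   assignments to n separated balls.  Letting the radius tend to 0 and exchanging points and times
   turns this into arbitrarily long independence sets for n distinct points; concatenating blocks
   of rapidly growing length gives sequences with the required entropy. *)
theory Submission
  imports Defs
begin

section \<open>Ultrafilters and idempotents\<close>

definition ultra :: "'i filter \<Rightarrow> bool" where
  "ultra U \<longleftrightarrow> U \<noteq> bot \<and> (\<forall>P. eventually P U \<or> eventually (\<lambda>x. \<not> P x) U)"

text \<open>Finer filters are smaller in the order on filters, so an ultrafilter is a minimal
  element among the filters other than \<open>bot\<close> below \<open>F\<close>; Zorn's lemma is
  applied with the order reversed.\<close>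

lemma ultra_exists:
  assumes "F \<noteq> bot"
  obtains U where "U \<le> F" "ultra U"
proof -
  define A where "A = {G. G \<noteq> bot \<and> G \<le> F}"
  have "\<exists>m\<in>A. \<forall>a\<in>A. a \<le> m \<longrightarrow> a = m"
  proof (rule predicate_Zorn)
    show "partial_order_on A (relation_of (\<lambda>a b. b \<le> a) A)"
      by (auto simp: relation_of_def partial_order_on_def preorder_on_def refl_on_def trans_def
          antisym_def)
  next
    fix C assume C: "C \<in> Chains (relation_of (\<lambda>a b. b \<le> a) A)"
    then have CA: "C \<subseteq> A" and lin: "\<And>G H. G \<in> C \<Longrightarrow> H \<in> C \<Longrightarrow> G \<le> H \<or> H \<le> G"
      by (auto simp: Chains_def relation_of_def)
    show "\<exists>u\<in>A. \<forall>a\<in>C. u \<le> a"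
    proof (cases "C = {}")
      case True
      then show ?thesis using assms by (auto simp: A_def)
    next
      case False
      \<comment> \<open>In a chain, whatever holds eventually for the infimum already does so for a
        member; hence the infimum stays different from \<open>bot\<close>.\<close>
      have "eventually P (Inf C) \<longleftrightarrow> (\<exists>b\<in>C. eventually P b)" for P
      proof (rule eventually_Inf_base[OF False])
        fix G H assume "G \<in> C" "H \<in> C"
        with lin[of G H] show "\<exists>x\<in>C. x \<le> inf G H" by auto
      qed
      then have "Inf C \<noteq> bot"
        using CA unfolding A_def trivial_limit_def by blast
      moreover have "Inf C \<le> F"
      proof -
        obtain G where "G \<in> C" using False by blast
        with CA have "G \<le> F" unfolding A_def by blast
        with \<open>G \<in> C\<close> show ?thesis by (rule Inf_lower2)
      qed
      ultimately show ?thesis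
        by (auto simp: A_def intro!: bexI[of _ "Inf C"] Inf_lower)
    qed
  qed
  then obtain U where U: "U \<noteq> bot" "U \<le> F"
    and min: "\<And>a. a \<noteq> bot \<Longrightarrow> a \<le> U \<Longrightarrow> a = U"
    unfolding A_def by (metis (mono_tags, lifting) mem_Collect_eq order_trans)
  \<comment> \<open>Restricting \<open>U\<close> to \<open>P\<close> gives either
    \<open>bot\<close>, so that the negation holds eventually, or \<open>U\<close> itself by
    minimality.\<close>
  have "eventually P U \<or> eventually (\<lambda>x. \<not> P x) U" for P
  proof (cases "inf U (principal {x. P x}) = bot")
    case True
    then show ?thesis
      by (auto simp: trivial_limit_def eventually_inf_principal)
  next
    case False
    then have "inf U (principal {x. P x}) = U"
      by (intro min) auto
    moreover have "eventually P (inf U (principal {x. P x}))"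
      by (simp add: eventually_inf_principal)
    ultimately show ?thesis by simp
  qed
  with U that show thesis by (auto simp: ultra_def)
qed

lemma ultra_eventually_ex:
  assumes U: "ultra U" and "finite I" and "eventually (\<lambda>x. \<exists>i\<in>I. P i x) U"
  shows "\<exists>i\<in>I. eventually (P i) U"
proof (rule ccontr)
  assume "\<not> ?thesis"
  then have "\<forall>i\<in>I. eventually (\<lambda>x. \<not> P i x) U"
    using U by (auto simp: ultra_def)
  then have "eventually (\<lambda>x. \<forall>i\<in>I. \<not> P i x) U"
    using \<open>finite I\<close> by (simp add: eventually_ball_finite)
  with assms(3) have "eventually (\<lambda>x. False) U"
    by eventually_elim auto
  with U show False by (auto simp: ultra_def trivial_limit_def)
qed

text \<open>Compactness yields a cluster point of the image filter, and an ultrafilter converges to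
  every cluster point because it decides each neighbourhood.\<close>

lemma ultra_compact_limit:
  assumes U: "ultra U" and K: "compact K" and f: "eventually (\<lambda>m. f m \<in> K) U"
  obtains z where "z \<in> K" "(f \<longlongrightarrow> z) U"
proof -
  have nb: "filtermap f U \<noteq> bot" and ev: "eventually (\<lambda>x. x \<in> K) (filtermap f U)"
    using U f by (auto simp: ultra_def filtermap_bot_iff eventually_filtermap)
  obtain z where z: "z \<in> K" and zb: "inf (nhds z) (filtermap f U) \<noteq> bot"
    using K[unfolded compact_filter, rule_format, OF nb ev] by blast
  have "(f \<longlongrightarrow> z) U"
  proof (rule topological_tendstoI, rule ccontr)
    fix S assume S: "open S" "z \<in> S" and "\<not> eventually (\<lambda>x. f x \<in> S) U"
    then have "eventually (\<lambda>x. f x \<notin> S) U"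
      using U by (auto simp: ultra_def)
    moreover have "eventually (\<lambda>x. x \<in> S) (nhds z)"
      using S eventually_nhds by blast
    ultimately have "eventually (\<lambda>x. False) (inf (nhds z) (filtermap f U))"
      unfolding eventually_inf by (auto simp: eventually_filtermap)
    with zb show False by (simp add: trivial_limit_def)
  qed
  with z that show thesis by blast
qed

section \<open>The topology of pointwise convergence\<close>

lemma tendsto_fun_iff:
  fixes f :: "'c \<Rightarrow> 'a \<Rightarrow> 'b::topological_space"
  shows "(f \<longlongrightarrow> l) F \<longleftrightarrow> (\<forall>i. ((\<lambda>c. f c i) \<longlongrightarrow> l i) F)"
  using limitin_componentwise[of "\<lambda>_. euclidean" UNIV f l F]
  by (simp add: euclidean_product_topology)

text \<open>The product of the metric factors is Hausdorff, even over an uncountable index type,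
  where it need not be metrizable.\<close>

lemma compact_imp_closed_fun:
  fixes S :: "('a \<Rightarrow> 'b::metric_space) set"
  assumes "compact S"
  shows "closed S"
proof -
  have "Hausdorff_space (euclidean :: ('a \<Rightarrow> 'b) topology)"
    unfolding euclidean_product_topology[symmetric]
    by (simp add: Hausdorff_space_product_topology Hausdorff_space_euclidean)
  then show ?thesis
    using assms compactin_imp_closedin by fastforce
qed

lemma compact_PiE_UNIV:
  fixes K :: "'a \<Rightarrow> 'b::topological_space set"
  assumes "\<And>i. compact (K i)"
  shows "compact (PiE UNIV K)"
  using compactin_PiE[of "\<lambda>_. euclidean" UNIV K] assms
  by (simp add: euclidean_product_topology)

text \<open>Evaluating \<open>f \<circ> g\<close> at a point is evaluating \<open>f\<close> at
  another point, so \<open>g\<close> may be arbitrary.\<close>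

lemma continuous_on_comp_right:
  fixes g :: "'a \<Rightarrow> 'a"
  shows "continuous_on UNIV (\<lambda>f :: 'a \<Rightarrow> 'b::topological_space. f \<circ> g)"
  by (rule continuous_on_coordinatewise_then_product) (simp add: comp_def)

text \<open>Ellis--Numakura: composition is only continuous in its left argument.\<close>
lemma ellis_numakura:
  fixes S :: "('a::metric_space \<Rightarrow> 'a) set"
  assumes S: "compact S" "S \<noteq> {}" "\<And>f g. f \<in> S \<Longrightarrow> g \<in> S \<Longrightarrow> f \<circ> g \<in> S"
  obtains p where "p \<in> S" "p \<circ> p = p"
proof -
  \<comment> \<open>The nonempty compact subsemigroups of \<open>S\<close>. Every element of a
    minimal one will turn out to be idempotent.\<close>
  define A where "A = {M. compact M \<and> M \<noteq> {} \<and> M \<subseteq> S \<and> (\<forall>f\<in>M. \<forall>g\<in>M. f \<circ> g \<in> M)}"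
  have "\<exists>m\<in>A. \<forall>a\<in>A. a \<subseteq> m \<longrightarrow> a = m"
  proof (rule predicate_Zorn)
    show "partial_order_on A (relation_of (\<lambda>a b. b \<subseteq> a) A)"
      by (auto simp: relation_of_def partial_order_on_def preorder_on_def refl_on_def trans_def
          antisym_def)
  next
    fix C assume C: "C \<in> Chains (relation_of (\<lambda>a b. b \<subseteq> a) A)"
    then have CA: "C \<subseteq> A" and lin: "\<And>G H. G \<in> C \<Longrightarrow> H \<in> C \<Longrightarrow> G \<subseteq> H \<or> H \<subseteq> G"
      by (auto simp: Chains_def relation_of_def)
    show "\<exists>u\<in>A. \<forall>a\<in>C. u \<subseteq> a"
    proof (cases "C = {}")
      case True
      then show ?thesis using S by (auto simp: A_def)
    next
      case False
      have cl: "closed M" if "M \<in> C" for M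
        using that CA compact_imp_closed_fun by (auto simp: A_def)
      \<comment> \<open>A finite part of a chain has a lower bound in the chain; this supplies the
        finite intersection property.\<close>
      have fin: "\<exists>M\<in>C. M \<subseteq> \<Inter>F" if "finite F" "F \<subseteq> C" for F
        using that
      proof induct
        case empty
        then show ?case using False by auto
      next
        case (insert M F)
        then obtain N where N: "N \<in> C" "N \<subseteq> \<Inter>F" by auto
        have "M \<in> C" using insert.prems by simp
        from lin[OF this N(1)] show ?case
        proof
          assume "M \<subseteq> N"
          with N have "M \<subseteq> \<Inter>(insert M F)" by auto
          with \<open>M \<in> C\<close> show ?thesis by blast
        next
          assume "N \<subseteq> M"
          with N have "N \<subseteq> \<Inter>(insert M F)" by auto
          with \<open>N \<in> C\<close> show ?thesis by blast
        qed
      qed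
      have ne: "S \<inter> \<Inter>C \<noteq> {}"
      proof (rule compact_imp_fip[OF S(1) cl])
        fix F assume F: "finite F" "F \<subseteq> C"
        obtain M where "M \<in> C" "M \<subseteq> \<Inter>F" using fin[OF F] by blast
        moreover have "M \<noteq> {}" "M \<subseteq> S" using \<open>M \<in> C\<close> CA by (auto simp: A_def)
        ultimately show "S \<inter> \<Inter>F \<noteq> {}" by blast
      qed auto
      have "compact (S \<inter> \<Inter>C)"
        using S(1) cl by (intro compact_Int_closed closed_Inter) auto
      moreover have "\<forall>f\<in>S \<inter> \<Inter>C. \<forall>g\<in>S \<inter> \<Inter>C. f \<circ> g \<in> S \<inter> \<Inter>C"
      proof (intro ballI IntI InterI)
        fix f g assume fg: "f \<in> S \<inter> \<Inter>C" "g \<in> S \<inter> \<Inter>C"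
        show "f \<circ> g \<in> S" using fg by (intro S(3)) simp_all
        fix M assume "M \<in> C"
        then have "M \<in> A" "f \<in> M" "g \<in> M" using CA fg by blast+
        then show "f \<circ> g \<in> M" unfolding A_def by simp
      qed
      ultimately have "S \<inter> \<Inter>C \<in> A" using ne unfolding A_def by simp
      moreover have "\<forall>a\<in>C. S \<inter> \<Inter>C \<subseteq> a" by blast
      ultimately show ?thesis by (rule bexI[rotated])
    qed
  qed
  then obtain M where MA: "M \<in> A" and min': "\<forall>a\<in>A. a \<subseteq> M \<longrightarrow> a = M" by (elim bexE)
  have M: "compact M" "M \<noteq> {}" "M \<subseteq> S" "\<And>f g. f \<in> M \<Longrightarrow> g \<in> M \<Longrightarrow> f \<circ> g \<in> M"
    using MA unfolding A_def by simp_all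
  have min: "\<And>a. a \<in> A \<Longrightarrow> a \<subseteq> M \<Longrightarrow> a = M" using min' by simp
  obtain p where p: "p \<in> M" using M(2) by blast
  \<comment> \<open>The right translate of \<open>M\<close> by \<open>p\<close> is a compact
    subsemigroup of \<open>M\<close>, so by minimality it contains \<open>p\<close>, which gives
    \<open>s\<close> with \<open>s \<circ> p = p\<close>.\<close>
  have "(\<lambda>f. f \<circ> p) ` M = M"
  proof (rule min)
    have "compact ((\<lambda>f. f \<circ> p) ` M)"
      by (rule compact_continuous_image)
        (rule continuous_on_subset[OF continuous_on_comp_right subset_UNIV], rule M(1))
    moreover have "\<forall>f\<in>(\<lambda>f. f \<circ> p) ` M. \<forall>g\<in>(\<lambda>f. f \<circ> p) ` M. f \<circ> g \<in> (\<lambda>f. f \<circ> p) ` M"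
    proof (intro ballI, elim imageE, hypsubst, intro image_eqI)
      fix f g assume that: "f \<in> M" "g \<in> M"
      show "f \<circ> p \<circ> (g \<circ> p) = (f \<circ> p \<circ> g) \<circ> p" by (simp add: comp_assoc)
      show "f \<circ> p \<circ> g \<in> M" by (intro M(4) that p)
    qed
    moreover show sub: "(\<lambda>f. f \<circ> p) ` M \<subseteq> M"
      by (rule image_subsetI) (rule M(4)[OF _ p])
    ultimately show "(\<lambda>f. f \<circ> p) ` M \<in> A"
      using M(2,3) unfolding A_def by simp
  qed
  then obtain s where s: "s \<in> M" "s \<circ> p = p" using p by (metis imageE)
  have clf: "closed {f :: 'a \<Rightarrow> 'a. f \<circ> p = p}"
  proof -
    have "{f. f \<circ> p = p} = (\<Inter>x. {f. f (p x) = p x})"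
      by (auto simp: fun_eq_iff)
    moreover have "closed {f :: 'a \<Rightarrow> 'a. f (p x) = p x}" for x
      by (intro closed_Collect_eq) auto
    ultimately show ?thesis by auto
  qed
  \<comment> \<open>The elements fixing \<open>p\<close> from the left form a compact subsemigroup,
    nonempty because of \<open>s\<close>. By minimality \<open>p\<close> is one of them.\<close>
  have "M \<inter> {f. f \<circ> p = p} = M"
  proof (rule min)
    have "\<forall>f\<in>M \<inter> {f. f \<circ> p = p}. \<forall>g\<in>M \<inter> {f. f \<circ> p = p}. f \<circ> g \<in> M \<inter> {f. f \<circ> p = p}"
    proof (intro ballI IntI)
      fix f g assume fg: "f \<in> M \<inter> {f. f \<circ> p = p}" "g \<in> M \<inter> {f. f \<circ> p = p}"
      show "f \<circ> g \<in> M" using fg by (intro M(4)) simp_all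
      show "f \<circ> g \<in> {f. f \<circ> p = p}" using fg by (simp add: comp_assoc)
    qed
    moreover have "M \<inter> {f. f \<circ> p = p} \<noteq> {}" using s by blast
    moreover have "M \<inter> {f. f \<circ> p = p} \<subseteq> S" using M(3) by blast
    ultimately show "M \<inter> {f. f \<circ> p = p} \<in> A"
      using compact_Int_closed[OF M(1) clf] unfolding A_def by simp
  qed auto
  then have "p \<circ> p = p" using p by blast
  then show thesis using p M(3) that by blast
qed

section \<open>The Ellis semigroup of a distal system\<close>

text \<open>Distality enters through \<open>sep\<close> as a positive lower bound over all times, a
  form that survives pointwise limits of the powers of \<open>T\<close>.\<close>

locale distal_sys =
  fixes X :: "'a::metric_space set" and T :: "'a \<Rightarrow> 'a"
  assumes cpt: "compact X" and cont: "continuous_on X T" and inv: "x \<in> X \<Longrightarrow> T x \<in> X"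
    and sep: "x \<in> X \<Longrightarrow> y \<in> X \<Longrightarrow> x \<noteq> y \<Longrightarrow> \<exists>\<eta>>0. \<forall>n. \<eta> \<le> dist ((T ^^ n) x) ((T ^^ n) y)"
begin

lemma pow_in: "x \<in> X \<Longrightarrow> (T ^^ n) x \<in> X"
  by (induct n) (auto intro: inv)

lemma pow_cont: "continuous_on X (T ^^ n)"
proof (induct n)
  case (Suc n)
  have "continuous_on ((T ^^ n) ` X) T"
    using cont by (rule continuous_on_subset) (auto intro: pow_in)
  with Suc show ?case unfolding funpow.simps by (rule continuous_on_compose)
qed (simp add: continuous_on_id)

lemma pow_tendsto:
  assumes "(f \<longlongrightarrow> a) F" "eventually (\<lambda>m. f m \<in> X) F" "a \<in> X"
  shows "((\<lambda>m. (T ^^ n) (f m)) \<longlongrightarrow> (T ^^ n) a) F"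
  using continuous_on_tendsto_compose[OF pow_cont assms(1,3,2)] .

text \<open>Extending the powers by the identity outside \<open>X\<close> makes them total maps
  within a compact product.\<close>

definition pw :: "nat \<Rightarrow> 'a \<Rightarrow> 'a" where
  "pw n x = (if x \<in> X then (T ^^ n) x else x)"

lemma pw_0 [simp]: "pw 0 = id"
  by (auto simp: pw_def)

text \<open>The Ellis (enveloping) semigroup. The closure is taken for pointwise convergence, so its
  elements need not be continuous.\<close>

definition ell :: "('a \<Rightarrow> 'a) set" where
  "ell = closure (range pw)"

lemma pw_ell [simp]: "pw n \<in> ell"
  unfolding ell_def by (meson closure_subset rangeI subsetD)

lemma id_ell [simp]: "id \<in> ell"
  using pw_ell[of 0] by simp

lemma closed_ell: "closed ell"
  by (simp add: ell_def)

text \<open>By Tychonoff's theorem the product with factor \<open>X\<close> over points of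
  \<open>X\<close> and a singleton elsewhere is compact, and it contains all powers.\<close>

lemma ell_sub: "ell \<subseteq> PiE UNIV (\<lambda>x. if x \<in> X then X else {x})" (is "_ \<subseteq> ?P")
  and compact_ell: "compact ell"
proof -
  have c: "compact ?P"
    by (rule compact_PiE_UNIV) (simp add: cpt)
  show s: "ell \<subseteq> ?P"
    unfolding ell_def
    by (rule closure_minimal) (auto simp: pw_def pow_in c compact_imp_closed_fun)
  show "compact ell"
    using compact_Int_closed[OF c closed_ell] s by (simp add: Int_absorb1)
qed

lemma ell_in: "q \<in> ell \<Longrightarrow> x \<in> X \<Longrightarrow> q x \<in> X"
  and ell_out: "q \<in> ell \<Longrightarrow> x \<notin> X \<Longrightarrow> q x = x"
  using subsetD[OF ell_sub, of q] by (auto simp: PiE_def Pi_def split: if_splits)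

lemma ell_limit:
  assumes "F \<noteq> bot" "eventually (\<lambda>m. f m \<in> ell) F" "\<And>x. ((\<lambda>m. f m x) \<longlongrightarrow> q x) F"
  shows "q \<in> ell"
  using Lim_in_closed_set[OF closed_ell assms(2,1)] assms(3) by (simp add: tendsto_fun_iff)

text \<open>Closeness to \<open>q\<close> at finitely many points defines an open neighbourhood of
  \<open>q\<close> in the product topology, which meets the powers.\<close>

lemma ell_approx:
  assumes "q \<in> ell" "finite F" "F \<subseteq> X" "e > 0"
  obtains n where "\<And>a. a \<in> F \<Longrightarrow> dist ((T ^^ n) a) (q a) < e"
proof -
  define S where "S = {f. \<forall>a\<in>F. f (id a) \<in> ball (q a) e}"
  have "open S"
    unfolding S_def by (rule product_topology_basis') (use assms in auto)
  moreover have "q \<in> S"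
    using assms by (auto simp: S_def)
  ultimately have "S \<inter> range pw \<noteq> {}"
    using assms(1) open_Int_closure_eq_empty[of S "range pw"] unfolding ell_def by auto
  then obtain n where "\<forall>a\<in>F. pw n a \<in> ball (q a) e" by (auto simp: S_def)
  then have "\<And>a. a \<in> F \<Longrightarrow> dist ((T ^^ n) a) (q a) < e"
    using assms(3) by (auto simp: pw_def dist_commute subset_iff)
  then show thesis by (rule that)
qed

text \<open>For fixed \<open>n\<close> the power is continuous on \<open>X\<close>, so composing
  with it on the left preserves pointwise limits of powers.\<close>

lemma pw_comp_ell:
  assumes g: "g \<in> ell"
  shows "pw n \<circ> g \<in> ell"
proof -
  \<comment> \<open>The trace on the powers of the neighbourhood filter of \<open>g\<close>; it is
    proper because \<open>g\<close> lies in their closure.\<close>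
  define F where "F = inf (nhds g) (principal (range pw))"
  have F: "F \<noteq> bot"
  proof
    assume "F = bot"
    then have "eventually (\<lambda>x. x \<notin> range pw) (nhds g)"
      by (simp add: F_def trivial_limit_def eventually_inf_principal)
    then obtain S where S: "open S" "g \<in> S" "\<forall>x\<in>S. x \<notin> range pw"
      by (auto simp: eventually_nhds)
    then have "S \<inter> range pw = {}" by auto
    with S(1) have "S \<inter> ell = {}"
      by (simp add: ell_def open_Int_closure_eq_empty)
    with S(2) g show False by blast
  qed
  have ev: "eventually (\<lambda>h. h \<in> range pw) F"
    by (simp add: F_def eventually_inf_principal)
  have "((\<lambda>h. h) \<longlongrightarrow> g) F"
    by (auto simp: F_def filterlim_def le_infI1)
  then have lim: "((\<lambda>h. h a) \<longlongrightarrow> g a) F" for a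
    by (simp add: tendsto_fun_iff)
  show ?thesis
  proof (rule ell_limit[OF F])
    have *: "pw n \<circ> pw k = pw (n + k)" for k
      by (auto simp: pw_def fun_eq_iff pow_in funpow_add)
    show "eventually (\<lambda>h. pw n \<circ> h \<in> ell) F"
      using ev by eventually_elim (auto simp: *)
    show "((\<lambda>h. (pw n \<circ> h) a) \<longlongrightarrow> (pw n \<circ> g) a) F" for a
    proof (cases "a \<in> X")
      case True
      have evX: "eventually (\<lambda>h. h a \<in> X) F"
        using ev by eventually_elim (use True pow_in in \<open>auto simp: pw_def\<close>)
      have "((\<lambda>h. (T ^^ n) (h a)) \<longlongrightarrow> (T ^^ n) (g a)) F"
        using lim evX ell_in[OF g True] by (rule pow_tendsto)
      moreover have "(pw n \<circ> g) a = (T ^^ n) (g a)"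
        using ell_in[OF g True] by (simp add: pw_def)
      moreover have "eventually (\<lambda>h. (T ^^ n) (h a) = (pw n \<circ> h) a) F"
        using evX by eventually_elim (simp add: pw_def)
      ultimately show ?thesis
        using Lim_transform_eventually by fastforce
    next
      case False
      then have "(pw n \<circ> g) a = a" by (simp add: ell_out[OF g] pw_def)
      moreover have "eventually (\<lambda>h. a = (pw n \<circ> h) a) F"
        using ev by eventually_elim (use False in \<open>auto simp: pw_def\<close>)
      ultimately show ?thesis
        using Lim_transform_eventually[OF tendsto_const] by fastforce
    qed
  qed
qed

text \<open>The maps whose composite with \<open>g\<close> stays in \<open>ell\<close> form a closed
  set; it contains all powers by \<open>pw_comp_ell\<close>, hence their closure.\<close>

lemma ell_comp:
  assumes "f \<in> ell" "g \<in> ell"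
  shows "f \<circ> g \<in> ell"
proof -
  have "closed ((\<lambda>f. f \<circ> g) -` ell)"
    using closed_ell continuous_on_comp_right by (rule closed_vimage)
  then have "ell \<subseteq> (\<lambda>f. f \<circ> g) -` ell"
    unfolding ell_def by (rule closure_minimal[rotated]) (use pw_comp_ell[OF assms(2)] ell_def in auto)
  with assms(1) show ?thesis by auto
qed

section \<open>Separation and left inverses in the Ellis semigroup\<close>

lemma ell_sep:
  assumes "a \<in> X" "b \<in> X" "a \<noteq> b"
  obtains \<eta> where "\<eta> > 0" "\<And>q. q \<in> ell \<Longrightarrow> \<eta> \<le> dist (q a) (q b)"
proof -
  obtain \<eta> where \<eta>: "\<eta> > 0" "\<And>n. \<eta> \<le> dist ((T ^^ n) a) ((T ^^ n) b)"
    using sep[OF assms] by blast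
  have "\<eta> \<le> dist (q a) (q b)" if q: "q \<in> ell" for q
  proof (rule ccontr)
    assume "\<not> ?thesis"
    \<comment> \<open>A power tracking \<open>q\<close> at both points within half the gap would
      bring the two orbits closer than \<open>\<eta>\<close>.\<close>
    then have e: "(\<eta> - dist (q a) (q b)) / 2 > 0" by simp
    obtain n where n: "\<And>c. c \<in> {a, b} \<Longrightarrow> dist ((T ^^ n) c) (q c) < (\<eta> - dist (q a) (q b)) / 2"
      by (rule ell_approx[OF q _ _ e, of "{a, b}"]) (use assms in auto)
    have "dist ((T ^^ n) a) ((T ^^ n) b) \<le> dist ((T ^^ n) a) (q a) + dist (q a) (q b) + dist ((T ^^ n) b) (q b)"
      using dist_triangle[of "(T ^^ n) a" "(T ^^ n) b" "q a"] dist_triangle[of "q a" "(T ^^ n) b" "q b"]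
      by (simp add: dist_commute)
    also have "\<dots> < \<eta>" using n[of a] n[of b] by (simp add: field_simps)
    finally show False using \<eta>(2)[of n] by simp
  qed
  with \<eta>(1) that show thesis by blast
qed

text \<open>The right translate of \<open>ell\<close> by \<open>q\<close> is a compact semigroup, so
  it contains an idempotent, necessarily of the form \<open>r \<circ> q\<close>.\<close>

lemma ell_left_inverse:
  assumes q: "q \<in> ell"
  obtains r where "r \<in> ell" "\<And>x. x \<in> X \<Longrightarrow> r (q x) = x"
proof -
  let ?S = "(\<lambda>f. f \<circ> q) ` ell"
  have "compact ?S"
    using compact_ell continuous_on_subset[OF continuous_on_comp_right subset_UNIV]
    by (rule compact_continuous_image[rotated])
  moreover have "?S \<noteq> {}" using q by blast
  moreover have "f \<circ> g \<in> ?S" if fg: "f \<in> ?S" "g \<in> ?S" for f g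
  proof -
    obtain f' where "f = f' \<circ> q" "f' \<in> ell" using fg(1) by (rule imageE)
    moreover obtain g' where "g = g' \<circ> q" "g' \<in> ell" using fg(2) by (rule imageE)
    ultimately have "f \<circ> g = (f' \<circ> (q \<circ> g')) \<circ> q" "f' \<circ> (q \<circ> g') \<in> ell"
      using q by (simp_all add: comp_assoc ell_comp)
    then show ?thesis by (rule image_eqI)
  qed
  ultimately obtain p where p: "p \<in> ?S" "p \<circ> p = p"
    by (rule ellis_numakura)
  then obtain r where r: "r \<in> ell" "p = r \<circ> q" by (elim imageE)
  have pe: "p \<in> ell" using r q by (simp add: ell_comp)
  txt \<open>The idempotent identifies \<^term>\<open>x\<close> and \<^term>\<open>p x\<close>, so distality forces them to agree.\<close>
  have "p x = x" if x: "x \<in> X" for x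
  proof (rule ccontr)
    assume "p x \<noteq> x"
    then obtain \<eta> where "\<eta> > 0" "\<eta> \<le> dist (p x) (p (p x))"
      using ell_sep[OF x ell_in[OF pe x]] pe by metis
    moreover have "p (p x) = p x" using p(2) by (metis comp_apply)
    ultimately show False by simp
  qed
  with r that show thesis by simp
qed

end

section \<open>Fibres over the Ellis semigroup\<close>

text \<open>Index \<open>0\<close> carries the limit point, so it can occur among the prescribed
  indices. The separation \<open>far\<close> fails for \<open>m = 0\<close> and is therefore only
  asked eventually.\<close>

locale distal_approach = distal_sys +
  fixes u :: "nat \<Rightarrow> 'a" and U :: "nat filter" and \<epsilon> :: real
  assumes u_in: "u m \<in> X" and u_lim: "u \<longlonglongrightarrow> u 0" and eps: "\<epsilon> > 0"
    and far: "eventually (\<lambda>m. \<exists>t. \<epsilon> \<le> dist ((T ^^ t) (u m)) ((T ^^ t) (u 0))) sequentially"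
    and U: "ultra U" and U_le: "U \<le> sequentially"
begin

lemma U_bot: "U \<noteq> bot"
  using U by (simp add: ultra_def)

definition near :: "('a \<Rightarrow> 'a) \<Rightarrow> nat set \<Rightarrow> real \<Rightarrow> nat set" where
  "near q F e = {t. \<forall>i\<in>F. dist ((T ^^ t) (u i)) (q (u i)) < e}"

definition hit :: "nat set \<Rightarrow> 'a set \<Rightarrow> bool" where
  "hit D V \<longleftrightarrow> eventually (\<lambda>m. \<exists>t\<in>D. (T ^^ t) (u m) \<in> V) U"

text \<open>The set \<open>F\<close> is fixed before \<open>m\<close> runs along \<open>U\<close>,
  but the time may depend on \<open>m\<close>. Times independent of \<open>m\<close> would leave
  only the point \<open>q (u 0)\<close>.\<close>

definition fib :: "('a \<Rightarrow> 'a) \<Rightarrow> 'a set" where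
  "fib q = {z\<in>X. \<forall>F e. finite F \<longrightarrow> e > 0 \<longrightarrow> hit (near q F e) (ball z e)}"

lemma fibD: "z \<in> fib q \<Longrightarrow> finite F \<Longrightarrow> e > 0 \<Longrightarrow> hit (near q F e) (ball z e)"
  by (simp add: fib_def)

lemma fib_in: "z \<in> fib q \<Longrightarrow> z \<in> X"
  by (simp add: fib_def)

lemma hit_mono: "hit D V \<Longrightarrow> D \<subseteq> D' \<Longrightarrow> V \<inter> X \<subseteq> V' \<Longrightarrow> hit D' V'"
  unfolding hit_def by (erule eventually_mono) (use pow_in u_in in blast)

lemma near_mono: "F' \<subseteq> F \<Longrightarrow> e \<le> e' \<Longrightarrow> near q F e \<subseteq> near q F' e'"
  by (force simp: near_def)

text \<open>One time approximating \<open>q\<close> at \<open>u 0\<close> and on \<open>F\<close>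
  serves almost all \<open>m\<close>, since its power is continuous at \<open>u 0\<close>.\<close>

lemma fib_base:
  assumes "q \<in> ell"
  shows "q (u 0) \<in> fib q"
proof -
  have "hit (near q F e) (ball (q (u 0)) e)" if F: "finite F" "e > 0" for F e
  proof -
    obtain n where n: "\<And>a. a \<in> u ` insert 0 F \<Longrightarrow> dist ((T ^^ n) a) (q a) < e"
      by (rule ell_approx[OF assms, of "u ` insert 0 F" e]) (use F u_in in auto)
    have "((\<lambda>m. (T ^^ n) (u m)) \<longlongrightarrow> (T ^^ n) (u 0)) sequentially"
      using u_lim u_in by (intro pow_tendsto) auto
    moreover have "(T ^^ n) (u 0) \<in> ball (q (u 0)) e"
      using n[of "u 0"] by (simp add: dist_commute)
    ultimately have "eventually (\<lambda>m. (T ^^ n) (u m) \<in> ball (q (u 0)) e) sequentially"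
      by (rule topological_tendstoD[OF _ open_ball])
    then have "eventually (\<lambda>m. (T ^^ n) (u m) \<in> ball (q (u 0)) e) U"
      using U_le by (simp add: le_filter_def)
    moreover have "n \<in> near q F e"
      using n by (auto simp: near_def)
    ultimately show ?thesis
      unfolding hit_def by (auto elim: eventually_mono)
  qed
  then show ?thesis using ell_in[OF assms u_in] by (simp add: fib_def)
qed

text \<open>A time \<open>t\<close> good for \<open>q\<close> is followed by a time \<open>s\<close>
  approximating \<open>r\<close> at \<open>z\<close> and at the points \<open>q (u i)\<close>. As
  \<open>s\<close> is fixed first, continuity of its power tells how close \<open>t\<close> has to
  bring the orbits, and \<open>s + t\<close> works for \<open>r \<circ> q\<close>.\<close>

lemma fib_act:
  assumes z: "z \<in> fib q" and q: "q \<in> ell" and r: "r \<in> ell"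
  shows "r z \<in> fib (r \<circ> q)"
proof -
  have "hit (near (r \<circ> q) F e) (ball (r z) e)" if F: "finite F" and e: "e > 0" for F e
  proof -
    define P where "P = insert z ((\<lambda>i. q (u i)) ` F)"
    have P: "finite P" "P \<subseteq> X"
      using F z q by (auto simp: P_def fib_in ell_in u_in)
    obtain s where s: "\<And>a. a \<in> P \<Longrightarrow> dist ((T ^^ s) a) (r a) < e / 2"
      by (rule ell_approx[OF r P, of "e / 2"]) (use e in auto)
    have "\<forall>a\<in>P. \<exists>d>0. \<forall>b\<in>X. dist b a < d \<longrightarrow> dist ((T ^^ s) b) ((T ^^ s) a) < e / 2"
      using pow_cont[of s] P(2) e unfolding continuous_on_iff by (meson half_gt_zero subsetD)
    then obtain d where d: "\<And>a. a \<in> P \<Longrightarrow> d a > 0"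
      "\<And>a b. a \<in> P \<Longrightarrow> b \<in> X \<Longrightarrow> dist b a < d a \<Longrightarrow> dist ((T ^^ s) b) ((T ^^ s) a) < e / 2"
      by metis
    define \<delta> where "\<delta> = Min (d ` P)"
    have \<delta>: "\<delta> > 0" "\<And>a. a \<in> P \<Longrightarrow> \<delta> \<le> d a"
      using P(1) d(1) by (auto simp: \<delta>_def P_def)
    have close: "dist ((T ^^ s) b) (r a) < e" if "a \<in> P" "b \<in> X" "dist b a < \<delta>" for a b
    proof -
      have "dist ((T ^^ s) b) ((T ^^ s) a) < e / 2"
        using that \<delta> d(2) by force
      moreover have "dist (r a) ((T ^^ s) a) < e / 2"
        using s[OF that(1)] by (simp add: dist_commute)
      ultimately show ?thesis by (rule dist_triangle_half_l)
    qed
    have "hit (near q F \<delta>) (ball z \<delta>)"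
      using z F \<delta>(1) by (rule fibD)
    then show ?thesis unfolding hit_def
    proof (rule eventually_mono)
      fix m assume "\<exists>t\<in>near q F \<delta>. (T ^^ t) (u m) \<in> ball z \<delta>"
      then obtain t where t: "t \<in> near q F \<delta>" "dist ((T ^^ t) (u m)) z < \<delta>"
        by (auto simp: dist_commute)
      have "s + t \<in> near (r \<circ> q) F e"
        using t(1) close by (auto simp: near_def funpow_add P_def pow_in u_in)
      moreover have "(T ^^ (s + t)) (u m) \<in> ball (r z) e"
        using close[of z "(T ^^ t) (u m)"] t(2) by (simp add: funpow_add P_def pow_in u_in dist_commute)
      ultimately show "\<exists>t\<in>near (r \<circ> q) F e. (T ^^ t) (u m) \<in> ball (r z) e" ..
    qed
  qed
  then show ?thesis using ell_in[OF r fib_in[OF z]] by (simp add: fib_def)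
qed

text \<open>The limits along \<open>U\<close> of the pairs stopped at their first separation stay at
  least \<open>c\<close> and at most \<open>\<eta>\<close> apart.\<close>

lemma fib_close_pair:
  assumes "\<eta> > 0"
  obtains q z where "q \<in> ell" "z \<in> fib q" "z \<noteq> q (u 0)" "dist z (q (u 0)) \<le> \<eta>"
proof -
  have "uniformly_continuous_on X T"
    using cont cpt by (rule compact_uniformly_continuous)
  then obtain \<delta> where \<delta>: "\<delta> > 0"
    "\<And>a b. a \<in> X \<Longrightarrow> b \<in> X \<Longrightarrow> dist a b < \<delta> \<Longrightarrow> dist (T a) (T b) < \<eta>"
    using assms unfolding uniformly_continuous_on_def by metis
  \<comment> \<open>At most \<open>\<epsilon>\<close>, so that the separation \<open>c\<close> is
    reached; at most \<open>\<delta>\<close>, so that uniform continuity applies one step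
    earlier.\<close>
  define c where "c = min \<delta> \<epsilon>"
  have c: "c > 0" using \<delta>(1) eps by (simp add: c_def)
  define far_at where "far_at m t \<longleftrightarrow> c \<le> dist ((T ^^ t) (u m)) ((T ^^ t) (u 0))" for m t
  \<comment> \<open>One step before time \<open>t m\<close> the distance is below \<open>\<delta>\<close>, so at time \<open>t m\<close> it is at most \<open>\<eta>\<close>.\<close>
  define t where "t m = (LEAST t. far_at m t)" for m
  have "eventually (\<lambda>m. dist (u m) (u 0) < c) sequentially"
    using u_lim c by (rule tendstoD)
  with far have "eventually (\<lambda>m. c \<le> dist ((T ^^ t m) (u m)) ((T ^^ t m) (u 0))
      \<and> dist ((T ^^ t m) (u m)) ((T ^^ t m) (u 0)) \<le> \<eta>) sequentially"
  proof eventually_elim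
    case (elim m)
    then obtain s where "far_at m s" unfolding far_at_def c_def by (meson min.coboundedI2)
    then have tm: "far_at m (t m)" unfolding t_def by (rule LeastI)
    have "\<not> far_at m 0" using elim by (simp add: far_at_def)
    with tm have "t m \<noteq> 0" by metis
    then obtain k where k: "t m = Suc k" using not0_implies_Suc by blast
    then have "\<not> far_at m k" unfolding t_def by (metis lessI not_less_Least)
    then have "dist ((T ^^ k) (u m)) ((T ^^ k) (u 0)) < \<delta>"
      by (simp add: far_at_def c_def)
    then have "dist ((T ^^ t m) (u m)) ((T ^^ t m) (u 0)) < \<eta>"
      unfolding k using \<delta>(2) pow_in u_in by simp
    with tm show ?case by (simp add: far_at_def)
  qed
  then have ev: "eventually (\<lambda>m. c \<le> dist ((T ^^ t m) (u m)) ((T ^^ t m) (u 0))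
      \<and> dist ((T ^^ t m) (u m)) ((T ^^ t m) (u 0)) \<le> \<eta>) U"
    using U_le by (simp add: le_filter_def)
  \<comment> \<open>The ultrafilter gives limits at all points simultaneously, and together they
    define \<open>q\<close>.\<close>
  have "\<exists>l. ((\<lambda>m. pw (t m) a) \<longlongrightarrow> l) U" for a
  proof (cases "a \<in> X")
    case True
    show ?thesis
      by (rule ultra_compact_limit[OF U cpt, of "\<lambda>m. pw (t m) a"])
        (use True in \<open>auto simp: pw_def pow_in\<close>)
  next
    case False
    then show ?thesis by (auto simp: pw_def)
  qed
  then obtain q where q: "\<And>a. ((\<lambda>m. pw (t m) a) \<longlongrightarrow> q a) U" by metis
  have qe: "q \<in> ell"
    using U_bot q by (intro ell_limit[of U "\<lambda>m. pw (t m)"]) auto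
  obtain z where z: "z \<in> X" "((\<lambda>m. (T ^^ t m) (u m)) \<longlongrightarrow> z) U"
    by (rule ultra_compact_limit[OF U cpt, of "\<lambda>m. (T ^^ t m) (u m)"]) (auto simp: pow_in u_in)
  have qX: "((\<lambda>m. (T ^^ t m) (u i)) \<longlongrightarrow> q (u i)) U" for i
    using q[of "u i"] by (simp add: pw_def u_in)
  have d: "((\<lambda>m. dist ((T ^^ t m) (u m)) ((T ^^ t m) (u 0))) \<longlongrightarrow> dist z (q (u 0))) U"
    by (intro tendsto_dist z qX)
  have "c \<le> dist z (q (u 0))"
    using ev by (intro tendsto_lowerbound[OF d _ U_bot]) (auto elim: eventually_mono)
  moreover have "dist z (q (u 0)) \<le> \<eta>"
    using ev by (intro tendsto_upperbound[OF d _ U_bot]) (auto elim: eventually_mono)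
  moreover have "z \<in> fib q"
  proof -
    have "hit (near q F e) (ball z e)" if F: "finite F" "e > 0" for F e
    proof -
      have "eventually (\<lambda>m. \<forall>i\<in>F. dist ((T ^^ t m) (u i)) (q (u i)) < e) U"
        using F qX by (intro eventually_ball_finite) (auto intro: tendstoD)
      moreover have "eventually (\<lambda>m. dist ((T ^^ t m) (u m)) z < e) U"
        using z(2) F(2) by (rule tendstoD)
      ultimately show ?thesis
        unfolding hit_def by eventually_elim (auto simp: near_def dist_commute)
    qed
    with z(1) show ?thesis by (simp add: fib_def)
  qed
  ultimately show thesis using that[of q z] qe c by force
qed

section \<open>Infinitude of the fibre over the identity\<close>

lemma finite_sep:
  assumes "finite Z" "Z \<subseteq> X"
  obtains \<eta> where "\<eta> > 0"
    "\<And>q a b. q \<in> ell \<Longrightarrow> a \<in> Z \<Longrightarrow> b \<in> Z \<Longrightarrow> a \<noteq> b \<Longrightarrow> \<eta> \<le> dist (q a) (q b)"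
proof -
  have "\<forall>p\<in>Z \<times> Z. \<exists>\<eta>>0. fst p \<noteq> snd p \<longrightarrow> (\<forall>q\<in>ell. \<eta> \<le> dist (q (fst p)) (q (snd p)))"
  proof
    fix p assume "p \<in> Z \<times> Z"
    then have "fst p \<in> X" "snd p \<in> X" using assms by auto
    then show "\<exists>\<eta>>0. fst p \<noteq> snd p \<longrightarrow> (\<forall>q\<in>ell. \<eta> \<le> dist (q (fst p)) (q (snd p)))"
      by (metis ell_sep zero_less_one)
  qed
  then obtain h where h: "\<And>p. p \<in> Z \<times> Z \<Longrightarrow> h p > 0"
    "\<And>p q. p \<in> Z \<times> Z \<Longrightarrow> fst p \<noteq> snd p \<Longrightarrow> q \<in> ell \<Longrightarrow> h p \<le> dist (q (fst p)) (q (snd p))"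
    by metis
  \<comment> \<open>The \<open>1\<close> gives the minimum a value when \<open>Z\<close> is empty;
    diagonal pairs contribute arbitrary positive numbers.\<close>
  let ?\<eta> = "Min (insert 1 (h ` (Z \<times> Z)))"
  have f: "finite (insert 1 (h ` (Z \<times> Z)))" using assms by simp
  show thesis
  proof (rule that[of ?\<eta>])
    show "?\<eta> > 0" using f h(1) by (subst Min_gr_iff) auto
    fix q a b assume "q \<in> ell" "a \<in> Z" "b \<in> Z" "a \<noteq> b"
    with h(2)[of "(a, b)" q] Min_le[OF f, of "h (a, b)"] show "?\<eta> \<le> dist (q a) (q b)"
      by force
  qed
qed

text \<open>A close pair in the fibre over \<open>q\<close> is pulled back by the left inverse
  \<open>r\<close> to two distinct points over the identity that \<open>q\<close> brings close
  again. In a finite fibre this contradicts the uniform separation.\<close>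

lemma infinite_fib: "infinite (fib id)"
proof
  assume fin: "finite (fib id)"
  obtain \<eta> where \<eta>: "\<eta> > 0"
    "\<And>q a b. q \<in> ell \<Longrightarrow> a \<in> fib id \<Longrightarrow> b \<in> fib id \<Longrightarrow> a \<noteq> b \<Longrightarrow> \<eta> \<le> dist (q a) (q b)"
    by (rule finite_sep[OF fin]) (auto simp: fib_in)
  obtain q z where qz: "q \<in> ell" "z \<in> fib q" "z \<noteq> q (u 0)" "dist z (q (u 0)) \<le> \<eta> / 2"
    by (rule fib_close_pair[of "\<eta> / 2"]) (use \<eta> in auto)
  obtain r where r: "r \<in> ell" "\<And>x. x \<in> X \<Longrightarrow> r (q x) = x"
    by (rule ell_left_inverse[OF qz(1)]) blast
  have rqx: "(r \<circ> q) x = x" for x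
    by (cases "x \<in> X") (auto simp: r ell_out[OF qz(1)] ell_out[OF r(1)])
  then have rq: "r \<circ> q = id" by (auto simp: fun_eq_iff)
  have rz: "r z \<in> fib id"
    using fib_act[OF qz(2,1) r(1)] by (simp add: rq)
  \<comment> \<open>By \<open>ell_sep\<close> the map \<open>r\<close> is injective on
    \<open>X\<close>, so the left inverse of \<open>q\<close> is also a right inverse there.\<close>
  have "q (r z) = z"
  proof (rule ccontr)
    assume ne: "q (r z) \<noteq> z"
    have zX: "z \<in> X" "q (r z) \<in> X" using qz r fib_in ell_in by blast+
    obtain h where "h > 0" "h \<le> dist (r (q (r z))) (r z)"
      by (rule ell_sep[OF zX(2,1) ne]) (use r(1) in blast)
    moreover have "r (q (r z)) = r z" using rqx[of "r z"] by simp
    ultimately show False by simp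
  qed
  moreover have "u 0 \<in> fib id" using fib_base[of id] by simp
  ultimately have "r z \<noteq> u 0 \<Longrightarrow> \<eta> \<le> dist z (q (u 0))"
    using \<eta>(2)[OF qz(1) rz] by metis
  moreover have "r z \<noteq> u 0" using \<open>q (r z) = z\<close> qz(3) by auto
  ultimately show False using qz(4) \<eta>(1) by simp
qed

end

section \<open>Independence sets\<close>

text \<open>Combinatorial independence of a set of times for the balls of radius \<open>e\<close>
  about \<open>P\<close>.\<close>

definition indep :: "'a::metric_space set \<Rightarrow> ('a \<Rightarrow> 'a) \<Rightarrow> 'a set \<Rightarrow> real \<Rightarrow> nat set \<Rightarrow> bool" where
  "indep X T P e I \<longleftrightarrow> (\<forall>s\<in>I \<rightarrow>\<^sub>E P. \<exists>w\<in>X. \<forall>t\<in>I. dist (s t) ((T ^^ t) w) < e)"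

section \<open>Stable patterns and shattering by orbit points\<close>

context distal_approach
begin

text \<open>Nonempty preimages of basic open sets of the product under the orbit of the sequence
  \<open>u\<close>; they are the refinements over which a pattern is minimised.\<close>

definition basic :: "nat set \<Rightarrow> bool" where
  "basic D \<longleftrightarrow> D \<noteq> {} \<and>
     (\<exists>F V. finite F \<and> (\<forall>i\<in>F. open (V i)) \<and> D = {t. \<forall>i\<in>F. (T ^^ t) (u i) \<in> V i})"

lemma basic_UNIV: "basic UNIV"
  unfolding basic_def by (auto intro!: exI[of _ "{}"])

lemma basic_Int:
  assumes "basic D" "open W" "{t\<in>D. (T ^^ t) (u m) \<in> W} \<noteq> {}"
  shows "basic {t\<in>D. (T ^^ t) (u m) \<in> W}"
proof -
  obtain F V where FV: "finite F" "\<forall>i\<in>F. open (V i)" "D = {t. \<forall>i\<in>F. (T ^^ t) (u i) \<in> V i}"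
    using assms(1) by (auto simp: basic_def)
  \<comment> \<open>If coordinate \<open>m\<close> is already constrained, the old and new
    conditions are intersected.\<close>
  define V' where "V' = (\<lambda>i. if i = m then if m \<in> F then V m \<inter> W else W else V i)"
  have "finite (insert m F)" "\<forall>i\<in>insert m F. open (V' i)"
    using FV assms(2) by (auto simp: V'_def)
  moreover have "{t\<in>D. (T ^^ t) (u m) \<in> W} = {t. \<forall>i\<in>insert m F. (T ^^ t) (u i) \<in> V' i}"
    unfolding FV(3) V'_def by auto
  ultimately show ?thesis
    unfolding basic_def using assms(3) by blast
qed

text \<open>This links the two kinds of time sets: what a point of the fibre over
  \<open>pw t\<close> hits along \<open>near\<close>, it hits within \<open>D\<close>.\<close>

lemma basic_near:
  assumes "basic D" "t \<in> D"
  obtains F e where "finite F" "e > 0" "near (pw t) F e \<subseteq> D"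
proof -
  obtain F V where FV: "finite F" "\<forall>i\<in>F. open (V i)" "D = {t. \<forall>i\<in>F. (T ^^ t) (u i) \<in> V i}"
    using assms(1) by (auto simp: basic_def)
  have "\<forall>i\<in>F. \<exists>e>0. ball ((T ^^ t) (u i)) e \<subseteq> V i"
  proof
    fix i assume "i \<in> F"
    then have "open (V i)" "(T ^^ t) (u i) \<in> V i" using FV assms(2) by auto
    then show "\<exists>e>0. ball ((T ^^ t) (u i)) e \<subseteq> V i" by (meson openE)
  qed
  from bchoice[OF this] obtain e where
    e: "\<And>i. i \<in> F \<Longrightarrow> e i > 0" "\<And>i. i \<in> F \<Longrightarrow> ball ((T ^^ t) (u i)) (e i) \<subseteq> V i"
    by blast
  define d where "d = Min (insert 1 (e ` F))"
  have d: "d > 0" "\<And>i. i \<in> F \<Longrightarrow> d \<le> e i"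
    using FV(1) e(1) by (auto simp: d_def)
  have "near (pw t) F d \<subseteq> D"
  proof
    fix s assume s: "s \<in> near (pw t) F d"
    have "(T ^^ s) (u i) \<in> V i" if "i \<in> F" for i
    proof (rule subsetD[OF e(2)[OF that]])
      show "(T ^^ s) (u i) \<in> ball ((T ^^ t) (u i)) (e i)"
        using s d(2)[OF that] that by (force simp: near_def pw_def u_in dist_commute)
    qed
    then show "s \<in> D" by (simp add: FV(3))
  qed
  with FV(1) d(1) that show thesis by blast
qed

text \<open>Refining a set of times can only lose balls from its pattern, so a pattern of least
  cardinality never changes again. For \<open>t\<close> in such a set, the fibre over
  \<open>pw t\<close> contains the images of \<open>Z\<close>, which lie in balls of the pattern;
  \<open>y z\<close> is a centre of one.\<close>

lemma stable_pattern:
  assumes Z: "Z \<subseteq> fib id" and \<delta>: "\<delta> > 0"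
  obtains D t y where "basic D" "\<And>z. z \<in> Z \<Longrightarrow> y z \<in> X" "\<And>z. z \<in> Z \<Longrightarrow> dist (y z) ((T ^^ t) z) < \<delta>"
    "\<And>D' z. D' \<subseteq> D \<Longrightarrow> basic D' \<Longrightarrow> z \<in> Z \<Longrightarrow> hit D' (ball (y z) \<delta>)"
proof -
  obtain C where C: "finite C" "C \<subseteq> X" "X \<subseteq> (\<Union>c\<in>C. ball c \<delta>)"
  proof (rule compactE_image[OF cpt, of X "\<lambda>c. ball c \<delta>"])
    show "X \<subseteq> (\<Union>c\<in>X. ball c \<delta>)" using \<delta> by force
  qed auto
  define pat where "pat D = {c\<in>C. hit D (ball c \<delta>)}" for D
  have pat_mono: "pat D' \<subseteq> pat D" if "D' \<subseteq> D" for D D'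
    using that hit_mono unfolding pat_def by blast
  have fin: "finite (pat D)" for D using C(1) by (simp add: pat_def)
  obtain D where D: "basic D" "\<And>D'. basic D' \<Longrightarrow> card (pat D) \<le> card (pat D')"
    using ex_has_least_nat[of basic UNIV "\<lambda>D. card (pat D)"] basic_UNIV by blast
  have stable: "pat D' = pat D" if "D' \<subseteq> D" "basic D'" for D'
    using card_seteq[OF fin pat_mono[OF that(1)] D(2)[OF that(2)]] .
  obtain t where t: "t \<in> D" using D(1) by (auto simp: basic_def)
  obtain F e where F: "finite F" "e > 0" "near (pw t) F e \<subseteq> D"
    using basic_near[OF D(1) t] .
  have "\<exists>c\<in>pat D. dist c ((T ^^ t) z) < \<delta>" if z: "z \<in> Z" for z
  proof -
    have zX: "z \<in> X" using z Z fib_in by blast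
    obtain c where c: "c \<in> C" "(T ^^ t) z \<in> ball c \<delta>"
      using C(3) pow_in[OF zX] by blast
    obtain e' where e': "e' > 0" "ball ((T ^^ t) z) e' \<subseteq> ball c \<delta>"
      using c(2) open_ball openE by blast
    have "pw t z \<in> fib (pw t \<circ> id)"
      using z Z fib_act[OF _ id_ell pw_ell] by blast
    \<comment> \<open>The radius \<open>e\<close> keeps the times in \<open>D\<close>, and
      \<open>e'\<close> keeps the positions in the ball about \<open>c\<close>.\<close>
    then have "hit (near (pw t) F (min e e')) (ball ((T ^^ t) z) (min e e'))"
      using fibD[of "(T ^^ t) z" "pw t" F "min e e'"] F e'(1) zX by (simp add: pw_def[of t z])
    moreover have "near (pw t) F (min e e') \<subseteq> D" using F(3) near_mono[of F F "min e e'" e] by auto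
    moreover have "ball ((T ^^ t) z) (min e e') \<inter> X \<subseteq> ball c \<delta>" using e'(2) by auto
    ultimately have "hit D (ball c \<delta>)" by (rule hit_mono)
    with c show ?thesis by (auto simp: pat_def)
  qed
  then obtain y where y: "\<And>z. z \<in> Z \<Longrightarrow> y z \<in> pat D" "\<And>z. z \<in> Z \<Longrightarrow> dist (y z) ((T ^^ t) z) < \<delta>"
    by metis
  show thesis
  proof (rule that[OF D(1) _ y(2)])
    show "y z \<in> X" if "z \<in> Z" for z using y(1)[OF that] C(2) by (auto simp: pat_def)
    show "hit D' (ball (y z) \<delta>)" if "D' \<subseteq> D" "basic D'" "z \<in> Z" for D' z
      using stable[OF that(1,2)] y(1)[OF that(3)] by (auto simp: pat_def)
  qed
qed

text \<open>Induction on \<open>k\<close>. Each assignment to the points chosen so far leaves a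
  basic set of times, on which every ball is hit for almost all indices. There are finitely many
  requirements, so one new index meets them all.\<close>

lemma shatter_points:
  assumes D: "basic D" and Z: "finite Z"
    and hit: "\<And>D' z. D' \<subseteq> D \<Longrightarrow> basic D' \<Longrightarrow> z \<in> Z \<Longrightarrow> hit D' (ball (y z) \<delta>)"
  shows "\<exists>m :: nat \<Rightarrow> nat. \<forall>\<sigma>\<in>{..<k} \<rightarrow>\<^sub>E Z.
    basic {t\<in>D. \<forall>i<k. (T ^^ t) (u (m i)) \<in> ball (y (\<sigma> i)) \<delta>}"
proof (induct k)
  case 0
  then show ?case using D by simp
next
  case (Suc k)
  then obtain m where m: "\<And>\<sigma>. \<sigma> \<in> {..<k} \<rightarrow>\<^sub>E Z \<Longrightarrow>
    basic {t\<in>D. \<forall>i<k. (T ^^ t) (u (m i)) \<in> ball (y (\<sigma> i)) \<delta>}" (is "\<And>\<sigma>. _ \<Longrightarrow> basic (?D \<sigma>)")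
    by blast
  have "eventually (\<lambda>n. \<forall>\<sigma>\<in>{..<k} \<rightarrow>\<^sub>E Z. \<forall>z\<in>Z. \<exists>t\<in>?D \<sigma>. (T ^^ t) (u n) \<in> ball (y z) \<delta>) U"
  proof (intro eventually_ball_finite ballI)
    show "finite ({..<k} \<rightarrow>\<^sub>E Z)" using Z by (simp add: finite_PiE)
    fix \<sigma> z assume "\<sigma> \<in> {..<k} \<rightarrow>\<^sub>E Z" "z \<in> Z"
    then have "hit (?D \<sigma>) (ball (y z) \<delta>)"
      by (intro hit m) auto
    then show "eventually (\<lambda>n. \<exists>t\<in>?D \<sigma>. (T ^^ t) (u n) \<in> ball (y z) \<delta>) U"
      unfolding hit_def .
  qed (rule Z)
  from eventually_happens'[OF U_bot this] obtain n where n: "\<And>\<sigma> z. \<sigma> \<in> {..<k} \<rightarrow>\<^sub>E Z \<Longrightarrow> z \<in> Z \<Longrightarrow> \<exists>t\<in>?D \<sigma>. (T ^^ t) (u n) \<in> ball (y z) \<delta>"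
    by blast
  show ?case
  proof (intro exI[of _ "m(k := n)"] ballI)
    fix \<sigma> assume \<sigma>: "\<sigma> \<in> {..<Suc k} \<rightarrow>\<^sub>E Z"
    define \<sigma>' where "\<sigma>' = restrict \<sigma> {..<k}"
    have s': "\<sigma>' \<in> {..<k} \<rightarrow>\<^sub>E Z" "\<sigma> k \<in> Z"
      using \<sigma> by (auto simp: \<sigma>'_def PiE_iff)
    have "basic {t\<in>?D \<sigma>'. (T ^^ t) (u n) \<in> ball (y (\<sigma> k)) \<delta>}"
      by (rule basic_Int) (use m[OF s'(1)] n[OF s'] in auto)
    also have "{t\<in>?D \<sigma>'. (T ^^ t) (u n) \<in> ball (y (\<sigma> k)) \<delta>} =
      {t\<in>D. \<forall>i<Suc k. (T ^^ t) (u ((m(k := n)) i)) \<in> ball (y (\<sigma> i)) \<delta>}"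
      by (auto simp: less_Suc_eq \<sigma>'_def)
    finally show "basic {t\<in>D. \<forall>i<Suc k. (T ^^ t) (u ((m(k := n)) i)) \<in> ball (y (\<sigma> i)) \<delta>}" .
  qed
qed

text \<open>The centres depend on the radius; their limits as it tends to 0 give one set
  \<open>P\<close> for all \<open>e\<close> and \<open>k\<close>, and the separation under
  \<open>ell\<close> keeps its points distinct.\<close>

lemma shatter_limit:
  obtains P where "finite P" "card P = n" "P \<subseteq> X"
    "\<And>e k. e > 0 \<Longrightarrow> \<exists>w. (\<forall>i<k. w i \<in> X) \<and>
       (\<forall>\<sigma>\<in>{..<k::nat} \<rightarrow>\<^sub>E P. \<exists>t. \<forall>i<k. dist (\<sigma> i) ((T ^^ t) (w i)) < e)"
proof -
  obtain Z where Z: "finite Z" "card Z = n" "Z \<subseteq> fib id"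
    using infinite_arbitrarily_large[OF infinite_fib] by blast
  then have ZX: "Z \<subseteq> X" using fib_in by blast
  obtain \<eta> where \<eta>: "\<eta> > 0"
    "\<And>q a b. q \<in> ell \<Longrightarrow> a \<in> Z \<Longrightarrow> b \<in> Z \<Longrightarrow> a \<noteq> b \<Longrightarrow> \<eta> \<le> dist (q a) (q b)"
    using finite_sep[OF Z(1) ZX] by metis
  define \<delta> where "\<delta> j = inverse (real (Suc j))" for j
  have \<delta>0: "\<delta> j > 0" for j by (simp add: \<delta>_def)
  have "\<exists>D t y. basic D \<and> (\<forall>z\<in>Z. y z \<in> X) \<and> (\<forall>z\<in>Z. dist (y z) ((T ^^ t) z) < \<delta> j) \<and>
    (\<forall>D' z. D' \<subseteq> D \<longrightarrow> basic D' \<longrightarrow> z \<in> Z \<longrightarrow> hit D' (ball (y z) (\<delta> j)))" for j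
    by (rule stable_pattern[OF Z(3) \<delta>0[of j]]) blast
  then obtain D t y where B: "\<And>j. basic (D j)"
    and yX: "\<And>j z. z \<in> Z \<Longrightarrow> y j z \<in> X"
    and yt: "\<And>j z. z \<in> Z \<Longrightarrow> dist (y j z) ((T ^^ t j) z) < \<delta> j"
    and yh: "\<And>j D' z. D' \<subseteq> D j \<Longrightarrow> basic D' \<Longrightarrow> z \<in> Z \<Longrightarrow> hit D' (ball (y j z) (\<delta> j))"
    by metis
  \<comment> \<open>Here \<open>U\<close> serves as an ultrafilter on the indices \<open>j\<close>
    of the radii.\<close>
  have "\<forall>z\<in>Z. \<exists>l\<in>X. ((\<lambda>j. y j z) \<longlongrightarrow> l) U"
  proof
    fix z assume "z \<in> Z"
    then have "eventually (\<lambda>j. y j z \<in> X) U" using yX by simp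
    then show "\<exists>l\<in>X. ((\<lambda>j. y j z) \<longlongrightarrow> l) U"
      using ultra_compact_limit[OF U cpt] by metis
  qed
  then obtain Y where Y: "\<And>z. z \<in> Z \<Longrightarrow> Y z \<in> X" "\<And>z. z \<in> Z \<Longrightarrow> ((\<lambda>j. y j z) \<longlongrightarrow> Y z) U"
    by metis
  have \<delta>lim: "(\<delta> \<longlongrightarrow> 0) U"
    using LIMSEQ_inverse_real_of_nat U_le unfolding \<delta>_def by (rule tendsto_mono[rotated])
  \<comment> \<open>The centres lie within \<open>\<delta> j\<close> of images of \<open>Z\<close>
    under one power, and these are \<open>\<eta>\<close>-separated.\<close>
  have "\<eta> \<le> dist (Y a) (Y b)" if ab: "a \<in> Z" "b \<in> Z" "a \<noteq> b" for a b
  proof (rule tendsto_le[OF U_bot _ tendsto_const])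
    show "((\<lambda>j. dist (y j a) (y j b) + 2 * \<delta> j) \<longlongrightarrow> dist (Y a) (Y b)) U"
      using tendsto_add[OF tendsto_dist[OF Y(2)[OF ab(1)] Y(2)[OF ab(2)]]
          tendsto_mult[OF tendsto_const[of 2] \<delta>lim]] by simp
    show "eventually (\<lambda>j. \<eta> \<le> dist (y j a) (y j b) + 2 * \<delta> j) U"
    proof (intro always_eventually allI)
      fix j
      have "\<eta> \<le> dist ((T ^^ t j) a) ((T ^^ t j) b)"
        using \<eta>(2)[of "pw (t j)" a b] ab subsetD[OF ZX ab(1)] subsetD[OF ZX ab(2)]
        by (simp add: pw_def)
      also have "\<dots> \<le> dist (y j a) ((T ^^ t j) a) + dist (y j a) (y j b) + dist (y j b) ((T ^^ t j) b)"
        using dist_triangle[of "(T ^^ t j) a" "(T ^^ t j) b" "y j a"]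
          dist_triangle[of "y j a" "(T ^^ t j) b" "y j b"] by (simp add: dist_commute)
      also have "\<dots> \<le> dist (y j a) (y j b) + 2 * \<delta> j"
        using yt[OF ab(1), of j] yt[OF ab(2), of j] by simp
      finally show "\<eta> \<le> dist (y j a) (y j b) + 2 * \<delta> j" .
    qed
  qed
  then have inj: "inj_on Y Z" using \<eta>(1) by (force simp: inj_on_def)
  show thesis
  proof (rule that[of "Y ` Z"])
    show "finite (Y ` Z)" "card (Y ` Z) = n" "Y ` Z \<subseteq> X"
      using Z Y inj by (auto simp: card_image)
    fix e :: real and k :: nat assume e: "e > 0"
    have "eventually (\<lambda>j. \<forall>z\<in>Z. dist (y j z) (Y z) < e / 2) U"
      using Z(1) tendstoD[OF Y(2), of _ "e / 2"] e by (intro eventually_ball_finite) auto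
    moreover have "eventually (\<lambda>j. \<delta> j < e / 2) U"
      using order_tendstoD(2)[OF \<delta>lim, of "e / 2"] e by simp
    ultimately have "eventually (\<lambda>j. (\<forall>z\<in>Z. dist (y j z) (Y z) < e / 2) \<and> \<delta> j < e / 2) U"
      by (rule eventually_conj)
    from eventually_happens'[OF U_bot this]
    obtain j where j: "\<And>z. z \<in> Z \<Longrightarrow> dist (y j z) (Y z) < e / 2" "\<delta> j < e / 2"
      by blast
    have "\<exists>m :: nat \<Rightarrow> nat. \<forall>\<sigma>\<in>{..<k} \<rightarrow>\<^sub>E Z.
      basic {s\<in>D j. \<forall>i<k. (T ^^ s) (u (m i)) \<in> ball (y j (\<sigma> i)) (\<delta> j)}"
      by (rule shatter_points[OF B Z(1)]) (rule yh)
    then obtain m :: "nat \<Rightarrow> nat" where m: "\<forall>\<sigma>\<in>{..<k} \<rightarrow>\<^sub>E Z.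
      basic {s\<in>D j. \<forall>i<k. (T ^^ s) (u (m i)) \<in> ball (y j (\<sigma> i)) (\<delta> j)}" by (elim exE)
    show "\<exists>w. (\<forall>i<k. w i \<in> X) \<and>
       (\<forall>\<sigma>\<in>{..<k} \<rightarrow>\<^sub>E Y ` Z. \<exists>t. \<forall>i<k. dist (\<sigma> i) ((T ^^ t) (w i)) < e)"
    proof (intro exI[of _ "\<lambda>i. u (m i)"] conjI ballI allI impI u_in)
      fix \<sigma> assume \<sigma>: "\<sigma> \<in> {..<k} \<rightarrow>\<^sub>E Y ` Z"
      \<comment> \<open>The assignment of limit points is translated back to labels in
        \<open>Z\<close>, for which the centres at level \<open>j\<close> are shattered.\<close>
      define \<tau> where "\<tau> = (\<lambda>i\<in>{..<k}. inv_into Z Y (\<sigma> i))"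
      have \<tau>Z: "\<tau> i \<in> Z" "Y (\<tau> i) = \<sigma> i" if "i < k" for i
      proof -
        have "\<sigma> i \<in> Y ` Z" using \<sigma> that by auto
        then show "\<tau> i \<in> Z" "Y (\<tau> i) = \<sigma> i"
          using that by (auto simp: \<tau>_def inv_into_into f_inv_into_f)
      qed
      then have "\<tau> \<in> {..<k} \<rightarrow>\<^sub>E Z" by (auto simp: \<tau>_def)
      with m have "basic {s\<in>D j. \<forall>i<k. (T ^^ s) (u (m i)) \<in> ball (y j (\<tau> i)) (\<delta> j)}" (is "basic ?B")
        by (rule bspec)
      then have "?B \<noteq> {}" by (simp add: basic_def)
      then obtain s where s: "\<And>i. i < k \<Longrightarrow> dist (y j (\<tau> i)) ((T ^^ s) (u (m i))) < \<delta> j"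
        by auto
      have "dist (\<sigma> i) ((T ^^ s) (u (m i))) < e" if i: "i < k" for i
      proof -
        have "dist (\<sigma> i) ((T ^^ s) (u (m i))) \<le> dist (y j (\<tau> i)) (\<sigma> i) + dist (y j (\<tau> i)) ((T ^^ s) (u (m i)))"
          by (rule dist_triangle3)
        also have "\<dots> < e" using s[OF i] j(1)[OF \<tau>Z(1)[OF i]] \<tau>Z(2)[OF i] j(2) by simp
        finally show ?thesis .
      qed
      then show "\<exists>t. \<forall>i<k. dist (\<sigma> i) ((T ^^ t) (u (m i))) < e" by blast
    qed
  qed
qed

end

section \<open>Exchange of points and times\<close>

lemma indep_subset:
  assumes "indep X T P e I" "J \<subseteq> I" "P \<noteq> {}"
  shows "indep X T P e J"
  unfolding indep_def
proof
  fix s assume s: "s \<in> J \<rightarrow>\<^sub>E P"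
  obtain p where "p \<in> P" using assms(3) by blast
  \<comment> \<open>Missing times get an arbitrary value in \<open>P\<close>; this is where
    \<open>P\<close> has to be nonempty.\<close>
  then have "(\<lambda>t\<in>I. if t \<in> J then s t else p) \<in> I \<rightarrow>\<^sub>E P" (is "?s \<in> _") using s by auto
  then obtain w where w: "w \<in> X" "\<forall>t\<in>I. dist (?s t) ((T ^^ t) w) < e"
    using assms(1) unfolding indep_def by blast
  have "dist (s t) ((T ^^ t) w) < e" if "t \<in> J" for t
    using bspec[OF w(2) subsetD[OF assms(2) that]] that subsetD[OF assms(2) that] by simp
  then show "\<exists>w\<in>X. \<forall>t\<in>J. dist (s t) ((T ^^ t) w) < e" using w(1) by blast
qed

text \<open>Take one point \<open>w j\<close> for every assignment \<open>h j\<close> on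
  \<open>k\<close> places. For a place \<open>i\<close>, the values \<open>h j i\<close> form an
  assignment to these points and are realised at one time \<open>t i\<close>. Read the other way,
  \<open>w j\<close> realises \<open>h j\<close> along the times \<open>t\<close>.\<close>

lemma indep_of_shatter:
  fixes P :: "'a::metric_space set"
  assumes P: "finite P" "card P \<ge> 2" and e: "e > 0"
    and sh: "\<And>e k. e > 0 \<Longrightarrow> \<exists>w. (\<forall>i<k. w i \<in> X) \<and>
       (\<forall>\<sigma>\<in>{..<k::nat} \<rightarrow>\<^sub>E P. \<exists>t. \<forall>i<k. dist (\<sigma> i) ((T ^^ t) (w i)) < e)"
  shows "\<exists>I. finite I \<and> card I = k \<and> indep X T P e I"
proof -
  obtain a b where ab: "a \<in> P" "b \<in> P" "a \<noteq> b"
    using P(2) by (metis P(1) card_2_iff' card_le_Suc0_iff_eq not_less_eq_eq numeral_2_eq_2)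
  \<comment> \<open>No point is within \<open>e'\<close> of both \<open>a\<close> and
    \<open>b\<close>, so different places must receive different times.\<close>
  define e' where "e' = min e (dist a b / 2)"
  have e': "e' > 0" using e ab by (simp add: e'_def)
  let ?S = "{..<k} \<rightarrow>\<^sub>E P"
  have "finite ?S" using P(1) by (simp add: finite_PiE)
  then obtain h where h: "bij_betw h {..<card ?S} ?S"
    using ex_bij_betw_nat_finite[of ?S] by (metis atLeast0LessThan)
  obtain w where w: "\<And>j. j < card ?S \<Longrightarrow> w j \<in> X"
    "\<And>\<sigma>. \<sigma> \<in> {..<card ?S} \<rightarrow>\<^sub>E P \<Longrightarrow> \<exists>t. \<forall>j<card ?S. dist (\<sigma> j) ((T ^^ t) (w j)) < e'"
    using sh[OF e', of "card ?S"] by blast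
  have hS: "h j \<in> ?S" if "j < card ?S" for j
    using h that by (auto simp: bij_betw_def)
  have "\<forall>i\<in>{..<k}. \<exists>t. \<forall>j<card ?S. dist (h j i) ((T ^^ t) (w j)) < e'"
  proof
    fix i assume "i \<in> {..<k}"
    then have "(\<lambda>j\<in>{..<card ?S}. h j i) \<in> {..<card ?S} \<rightarrow>\<^sub>E P"
      using hS by (auto simp: PiE_iff)
    from w(2)[OF this] show "\<exists>t. \<forall>j<card ?S. dist (h j i) ((T ^^ t) (w j)) < e'" by simp
  qed
  from bchoice[OF this] obtain t where
    "\<forall>i\<in>{..<k}. \<forall>j<card ?S. dist (h j i) ((T ^^ t i) (w j)) < e'" by (elim exE)
  then have t: "\<And>i j. i < k \<Longrightarrow> j < card ?S \<Longrightarrow> dist (h j i) ((T ^^ t i) (w j)) < e'"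
    by simp
  have pick: "\<exists>j<card ?S. h j = s" if "s \<in> ?S" for s
  proof -
    have "h ` {..<card ?S} = ?S" using h by (rule bij_betw_imp_surj_on)
    with that have "s \<in> h ` {..<card ?S}" by simp
    then show ?thesis by (elim imageE) auto
  qed
  \<comment> \<open>If two places shared a time, the point realising \<open>a\<close> at one and
    \<open>b\<close> at the other would be \<open>e'\<close>-close to both.\<close>
  have inj: "inj_on t {..<k}"
  proof (rule inj_onI, rule ccontr)
    fix i i' assume ii: "i \<in> {..<k}" "i' \<in> {..<k}" "t i = t i'" "i \<noteq> i'"
    have "(\<lambda>l\<in>{..<k}. if l = i then a else b) \<in> ?S" using ab by auto
    from pick[OF this] obtain j where j: "j < card ?S" "h j = (\<lambda>l\<in>{..<k}. if l = i then a else b)"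
      by blast
    have "dist a ((T ^^ t i) (w j)) < e'" using t[of i j] j ii by simp
    moreover have "dist b ((T ^^ t i) (w j)) < e'" using t[of i' j] j ii by simp
    ultimately have "dist a b < 2 * e'"
      using dist_triangle2[of a b "(T ^^ t i) (w j)"] by simp
    then show False by (simp add: e'_def)
  qed
  have "indep X T P e (t ` {..<k})"
    unfolding indep_def
  proof
    fix s assume s: "s \<in> t ` {..<k} \<rightarrow>\<^sub>E P"
    then have "(\<lambda>i\<in>{..<k}. s (t i)) \<in> ?S" by auto
    from pick[OF this] obtain j where j: "j < card ?S" "h j = (\<lambda>i\<in>{..<k}. s (t i))"
      by blast
    have "dist (s (t i)) ((T ^^ t i) (w j)) < e" if "i < k" for i
      using t[OF that j(1)] j(2) that by (simp add: e'_def)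
    then show "\<exists>w\<in>X. \<forall>t\<in>t ` {..<k}. dist (s t) ((T ^^ t) w) < e"
      using w(1)[OF j(1)] by (intro bexI[of _ "w j"]) auto
  qed
  moreover have "card (t ` {..<k}) = k" using inj by (simp add: card_image)
  ultimately show ?thesis by blast
qed

section \<open>Entropy along concatenated independence sets\<close>

lemma finite_join_cover:
  assumes "finite \<U>"
  shows "finite (join_cover X T A \<U> n)"
proof -
  have "join_cover X T A \<U> n \<subseteq> (\<lambda>f. X \<inter> (\<Inter>i<n. (T ^^ A i) -` f i)) ` ({..<n} \<rightarrow>\<^sub>E \<U>)"
  proof
    fix W assume "W \<in> join_cover X T A \<U> n"
    then obtain f where f: "W = X \<inter> (\<Inter>i<n. (T ^^ A i) -` f i)" "\<forall>i<n. f i \<in> \<U>"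
      by (auto simp: join_cover_def)
    show "W \<in> (\<lambda>f. X \<inter> (\<Inter>i<n. (T ^^ A i) -` f i)) ` ({..<n} \<rightarrow>\<^sub>E \<U>)"
      by (rule image_eqI[of _ _ "restrict f {..<n}"]) (use f in auto)
  qed
  moreover have "finite ({..<n} \<rightarrow>\<^sub>E \<U>)"
    using assms by (simp add: finite_PiE)
  ultimately show ?thesis
    using finite_surj by blast
qed

lemma join_cover_covers:
  assumes "X \<subseteq> \<Union>\<U>" "T ` X \<subseteq> X"
  shows "X \<subseteq> \<Union>(join_cover X T A \<U> n)"
proof
  fix x assume x: "x \<in> X"
  have "(T ^^ k) x \<in> X" for k by (induct k) (use x assms(2) in auto)
  then have "\<forall>i. \<exists>V\<in>\<U>. (T ^^ A i) x \<in> V" using assms(1) by blast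
  then obtain f where "\<And>i. f i \<in> \<U>" "\<And>i. (T ^^ A i) x \<in> f i" by metis
  then show "x \<in> \<Union>(join_cover X T A \<U> n)"
    using x by (auto simp: join_cover_def intro!: exI[of _ f])
qed

lemma Ncov_obtain:
  assumes "X \<subseteq> \<Union>\<V>"
  obtains \<W> where "\<W> \<subseteq> \<V>" "X \<subseteq> \<Union>\<W>" "card \<W> = Ncov X \<V>"
proof -
  have "\<exists>\<W>\<subseteq>\<V>. X \<subseteq> \<Union>\<W> \<and> card \<W> = Ncov X \<V>"
    unfolding Ncov_def by (rule LeastI[of _ "card \<V>"]) (use assms in auto)
  with that show thesis by blast
qed

text \<open>Every assignment is shadowed by a point of some member of a minimal subcover. A member
  of the join fixes one element of the cover at each time, leaving at most \<open>b\<close> values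
  there, so it accounts for at most \<open>b ^ card I\<close> assignments.\<close>

lemma Ncov_join_ge:
  assumes cov: "open_cover X \<U>" and inv: "T ` X \<subseteq> X" and P: "finite P" and I: "finite I"
    and ind: "indep X T P e I" and sub: "I \<subseteq> A ` {..<n}"
    and b: "\<And>V. V \<in> \<U> \<Longrightarrow> card {p\<in>P. \<exists>x\<in>V. dist p x < e} \<le> b"
  shows "card P ^ card I \<le> Ncov X (join_cover X T A \<U> n) * b ^ card I"
proof -
  have "X \<subseteq> \<Union>\<U>" "finite \<U>" using cov by (auto simp: open_cover_def)
  then obtain \<W> where \<W>: "\<W> \<subseteq> join_cover X T A \<U> n" "X \<subseteq> \<Union>\<W>"
      "card \<W> = Ncov X (join_cover X T A \<U> n)"
    and fin: "finite \<W>"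
    using Ncov_obtain[OF join_cover_covers[OF _ inv]] finite_join_cover finite_subset by metis
  define S where "S W = {s\<in>I \<rightarrow>\<^sub>E P. \<exists>x\<in>W. \<forall>t\<in>I. dist (s t) ((T ^^ t) x) < e}" for W
  have finS: "finite (I \<rightarrow>\<^sub>E P)" using P I by (simp add: finite_PiE)
  have "I \<rightarrow>\<^sub>E P \<subseteq> (\<Union>W\<in>\<W>. S W)"
  proof
    fix s assume s: "s \<in> I \<rightarrow>\<^sub>E P"
    then obtain x where x: "x \<in> X" "\<forall>t\<in>I. dist (s t) ((T ^^ t) x) < e"
      using ind unfolding indep_def by blast
    then obtain W where "W \<in> \<W>" "x \<in> W" using \<W>(2) by blast
    with s x show "s \<in> (\<Union>W\<in>\<W>. S W)" by (auto simp: S_def)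
  qed
  moreover have "finite (\<Union>W\<in>\<W>. S W)" using fin finS by (auto simp: S_def)
  ultimately have "card (I \<rightarrow>\<^sub>E P) \<le> card (\<Union>W\<in>\<W>. S W)" by (rule card_mono[rotated])
  also have "\<dots> \<le> (\<Sum>W\<in>\<W>. card (S W))" by (rule card_UN_le[OF fin])
  also have "\<dots> \<le> of_nat (card \<W>) * b ^ card I"
  proof (rule sum_bounded_above)
    fix W assume "W \<in> \<W>"
    then obtain f where f: "W = X \<inter> (\<Inter>i<n. (T ^^ A i) -` f i)" "\<And>i. i < n \<Longrightarrow> f i \<in> \<U>"
      using \<W>(1) by (auto simp: join_cover_def)
    define g where "g t = inv_into {..<n} A t" for t
    have g: "g t < n" "A (g t) = t" if "t \<in> I" for t
      using subsetD[OF sub that] inv_into_into[of t A "{..<n}"] f_inv_into_f[of t A "{..<n}"]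
      by (auto simp: g_def)
    let ?J = "\<lambda>t. {p\<in>P. \<exists>x\<in>f (g t). dist p x < e}"
    have "S W \<subseteq> PiE I ?J"
    proof
      fix s assume "s \<in> S W"
      then obtain x where s: "s \<in> I \<rightarrow>\<^sub>E P" and x: "x \<in> W" "\<And>t. t \<in> I \<Longrightarrow> dist (s t) ((T ^^ t) x) < e"
        by (auto simp: S_def)
      have "(T ^^ t) x \<in> f (g t)" if "t \<in> I" for t
      proof -
        have "(T ^^ A (g t)) x \<in> f (g t)" using x(1) g(1)[OF that] unfolding f(1) by blast
        then show ?thesis by (simp only: g(2)[OF that])
      qed
      with s x(2) show "s \<in> PiE I ?J" by (auto simp: PiE_iff)
    qed
    then have "card (S W) \<le> card (PiE I ?J)"
      using P I by (intro card_mono finite_PiE) auto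
    also have "\<dots> = (\<Prod>t\<in>I. card (?J t))" using I by (rule card_PiE)
    also have "\<dots> \<le> (\<Prod>t\<in>I. b)"
      using b f(2) g by (intro prod_mono) auto
    finally show "card (S W) \<le> b ^ card I" by simp
  qed
  finally show ?thesis by (simp add: card_PiE I \<W>(3))
qed

section \<open>Concatenation of blocks into one sequence\<close>

lemma down_closed_eq_lessThan:
  assumes "finite (D :: nat set)" "\<And>i j. i \<in> D \<Longrightarrow> j < i \<Longrightarrow> j \<in> D"
  shows "D = {..<card D}"
proof (cases "D = {}")
  case False
  have "D = {..Max D}"
  proof (rule set_eqI)
    fix i show "i \<in> D \<longleftrightarrow> i \<in> {..Max D}"
      using Max_in[OF assms(1) False] Max_ge[OF assms(1), of i] assms(2)[of "Max D" i]
      by (auto simp: le_less)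
  qed
  then have "card D = Suc (Max D)" by (metis card_atMost)
  with \<open>D = {..Max D}\<close> show ?thesis by (metis lessThan_Suc_atMost)
qed simp

text \<open>The enumeration is increasing and \<open>F\<close> lies below the rest of
  \<open>S\<close>, so the indices enumerating \<open>F\<close> are closed downwards.\<close>

lemma enumerate_initial_segment:
  fixes F S :: "nat set"
  assumes S: "infinite S" and F: "finite F" "F \<subseteq> S"
    and init: "\<And>x y. x \<in> F \<Longrightarrow> y \<in> S - F \<Longrightarrow> x < y"
  shows "F = enumerate S ` {..<card F}"
proof -
  define D where "D = enumerate S -` F"
  have bij: "bij_betw (enumerate S) UNIV S" using S by (rule bij_enumerate)
  have im: "enumerate S ` D = F"
    using bij F(2) unfolding D_def bij_betw_def by (simp add: Int_absorb2)
  have inj: "inj (enumerate S)" using bij by (rule bij_betw_imp_inj_on)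
  have D: "finite D" unfolding D_def using F(1) inj by (rule finite_vimageI)
  have "D = {..<card D}"
  proof (rule down_closed_eq_lessThan[OF D])
    fix i j assume ij: "i \<in> D" "j < i"
    show "j \<in> D"
    proof (rule ccontr)
      assume "j \<notin> D"
      then have "enumerate S j \<in> S - F" using enumerate_in_set[OF S] by (simp add: D_def)
      then have "enumerate S i < enumerate S j" using init ij(1) by (simp add: D_def)
      with enumerate_mono[OF ij(2) S] show False by simp
    qed
  qed
  moreover have "card D = card F"
    using im inj card_image[of "enumerate S" D] inj_on_subset by force
  ultimately show ?thesis using im by simp
qed

text \<open>Each new block has more than \<open>j + 1\<close> times as many elements as everything
  before it, so it fills at least the fraction (j+1)/(j+2) of the prefix of length
  \<open>N j\<close>.\<close>

lemma block_sequence: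
  assumes ind: "\<And>k. \<exists>I. finite I \<and> card I = k \<and> indep X T P e I" and P: "P \<noteq> {}"
  obtains A N where "strict_mono A" "strict_mono (N :: nat \<Rightarrow> nat)"
    "\<And>j. \<exists>I\<subseteq>A ` {..<N j}. finite I \<and> indep X T P e I \<and> Suc j * N j \<le> (j + 2) * card I"
proof -
  have step: "\<exists>I. finite I \<and> (\<forall>x\<in>S. \<forall>y\<in>I. x < y) \<and> card I = k \<and> indep X T P e I"
    if S: "finite S" for S :: "nat set" and k
  proof -
    obtain M where M: "\<forall>x\<in>S. x < M" using S finite_nat_set_iff_bounded by blast
    \<comment> \<open>The surplus of \<open>M\<close> elements pays for discarding the times below
      \<open>M\<close>, which may precede elements of \<open>S\<close>.\<close>
    obtain I where I: "finite I" "card I = k + M" "indep X T P e I" using ind by blast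
    have "k \<le> card (I - {..<M})"
      using diff_card_le_card_Diff[of "{..<M}" I] I(2) by simp
    then obtain J where J: "J \<subseteq> I - {..<M}" "card J = k" "finite J"
      by (rule obtain_subset_with_card_n)
    have "indep X T P e J" by (rule indep_subset[OF I(3) _ P]) (use J in blast)
    with J M show ?thesis by (intro exI[of _ J]) force
  qed
  \<comment> \<open>The summand \<open>1\<close> makes the set grow even from the empty set, so the
    prefix lengths increase strictly.\<close>
  have "\<exists>S. \<forall>j. finite (S j) \<and> (\<exists>I. finite I \<and> (\<forall>x\<in>S j. \<forall>y\<in>I. x < y) \<and>
    card I = Suc j * card (S j) + 1 \<and> indep X T P e I \<and> S (Suc j) = S j \<union> I)"
  proof (rule dependent_nat_choice)
    show "\<exists>S :: nat set. finite S" by blast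
    fix S :: "nat set" and j :: nat assume "finite S"
    from step[OF this] obtain I where I: "finite I" "\<forall>x\<in>S. \<forall>y\<in>I. x < y"
      "card I = Suc j * card S + 1" "indep X T P e I" by blast
    with \<open>finite S\<close> show "\<exists>S'. finite S' \<and> (\<exists>I. finite I \<and> (\<forall>x\<in>S. \<forall>y\<in>I. x < y) \<and>
        card I = Suc j * card S + 1 \<and> indep X T P e I \<and> S' = S \<union> I)"
      by (intro exI[of _ "S \<union> I"]) blast
  qed
  then obtain S where "\<forall>j. finite (S j :: nat set) \<and> (\<exists>I. finite I \<and> (\<forall>x\<in>S j. \<forall>y\<in>I. x < y) \<and>
      card I = Suc j * card (S j) + 1 \<and> indep X T P e I \<and> S (Suc j) = S j \<union> I)" by (elim exE)
  then have fin: "\<And>j. finite (S j)" and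
    "\<forall>j. \<exists>I. finite I \<and> (\<forall>x\<in>S j. \<forall>y\<in>I. x < y) \<and>
      card I = Suc j * card (S j) + 1 \<and> indep X T P e I \<and> S (Suc j) = S j \<union> I" by simp_all
  from choice[OF this(2)] obtain I where
    "\<forall>j. finite (I j) \<and> (\<forall>x\<in>S j. \<forall>y\<in>I j. x < y) \<and>
      card (I j) = Suc j * card (S j) + 1 \<and> indep X T P e (I j) \<and> S (Suc j) = S j \<union> I j"
    by (elim exE)
  then have I: "\<And>j. finite (I j)" "\<And>j x y. x \<in> S j \<Longrightarrow> y \<in> I j \<Longrightarrow> x < y"
    "\<And>j. card (I j) = Suc j * card (S j) + 1" "\<And>j. indep X T P e (I j)"
    "\<And>j. S (Suc j) = S j \<union> I j" by simp_all
  have card: "card (S (Suc j)) = card (S j) + card (I j)" for j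
    unfolding I(5) using fin I(1,2) by (intro card_Un_disjoint) force+
  have mono: "S j \<subseteq> S k" if "j \<le> k" for j k
    using that by (induct rule: dec_induct) (auto simp: I(5))
  have above: "x < y" if "j \<le> k" "x \<in> S j" "y \<in> S k - S j" for j k x y
    using that
  proof (induct arbitrary: y rule: dec_induct)
    case (step k)
    then show ?case using I(2)[of x k y] mono[of j k] by (auto simp: I(5))
  qed simp
  define A where "A = enumerate (\<Union>j. S j)"
  \<comment> \<open>Counted after block \<open>j\<close> has been added, so that the prefix ends
    with that block.\<close>
  define N where "N j = card (S (Suc j))" for j
  have smono: "strict_mono (\<lambda>j. card (S j))"
    by (rule strict_monoI_Suc) (simp add: card I(3))
  then have N: "strict_mono N"
    by (auto simp: N_def strict_mono_def)
  have inf: "infinite (\<Union>j. S j)"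
  proof
    assume f: "finite (\<Union>j. S j)"
    have "j \<le> card (\<Union>j. S j)" for j
      using strict_mono_imp_increasing[OF smono, of j] card_mono[OF f, of "S j"] by force
    then show False using not_less_eq_eq by blast
  qed
  show thesis
  proof (rule that[of A N])
    show "strict_mono A" unfolding A_def using inf enumerate_mono by (auto simp: strict_mono_def)
    show "strict_mono N" by (rule N)
    fix j
    have "S (Suc j) = A ` {..<N j}"
      unfolding A_def N_def
    proof (rule enumerate_initial_segment[OF inf fin])
      show "S (Suc j) \<subseteq> (\<Union>j. S j)" by blast
      fix x y assume xy: "x \<in> S (Suc j)" "y \<in> (\<Union>j. S j) - S (Suc j)"
      then obtain k where k: "y \<in> S k" by blast
      have "Suc j \<le> k"
        using mono[of k "Suc j"] k xy by (meson DiffD2 nat_le_linear subsetD)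
      with above xy k show "x < y" by blast
    qed
    then have "I j \<subseteq> A ` {..<N j}" using I(5)[of j] by auto
    moreover have "Suc j * N j \<le> (j + 2) * card (I j)"
    proof -
      have "Suc j * N j = Suc j * card (S j) + Suc j * card (I j)"
        unfolding N_def card by (rule distrib_left)
      also have "\<dots> \<le> card (I j) + Suc j * card (I j)" using I(3)[of j] by simp
      also have "\<dots> = (j + 2) * card (I j)" by simp
      finally show ?thesis .
    qed
    ultimately show "\<exists>I\<subseteq>A ` {..<N j}. finite I \<and> indep X T P e I \<and> Suc j * N j \<le> (j + 2) * card I"
      using I(1,4) by blast
  qed
qed

text \<open>Along the prefixes of length \<open>N j\<close> the growth rate is at least (j+1)/(j+2)
  times the claimed value, and the limsup over a subsequence bounds the full one from below.\<close>

lemma seq_entropy_cover_ge: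
  assumes cov: "open_cover X \<U>" and inv: "T ` X \<subseteq> X" and P: "finite P"
    and ind: "\<And>k. \<exists>I. finite I \<and> card I = k \<and> indep X T P e I"
    and b: "\<And>V. V \<in> \<U> \<Longrightarrow> card {p\<in>P. \<exists>x\<in>V. dist p x < e} \<le> b"
    and b1: "1 \<le> b" "b \<le> card P"
  obtains A where "strict_mono A" "ereal (ln (card P / b)) \<le> seq_entropy_cover X T A \<U>"
proof -
  have P0: "P \<noteq> {}" using b1 by auto
  obtain A N where A: "strict_mono A" and N: "strict_mono (N :: nat \<Rightarrow> nat)"
    and blk: "\<And>j. \<exists>I\<subseteq>A ` {..<N j}. finite I \<and> indep X T P e I \<and> Suc j * N j \<le> (j + 2) * card I"
    by (rule block_sequence[OF ind P0]) blast
  define c where "c = ln (card P / b)"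
  have c: "c \<ge> 0" using b1 by (simp add: c_def)
  define a where "a n = ln (real (Ncov X (join_cover X T A \<U> n))) / real n" for n
  have bound: "c * (real (Suc j) / real (j + 2)) \<le> a (N j)" if "N j > 0" for j
  proof -
    obtain I where I: "I \<subseteq> A ` {..<N j}" "finite I" "indep X T P e I" "Suc j * N j \<le> (j + 2) * card I"
      using blk by blast
    let ?M = "Ncov X (join_cover X T A \<U> (N j))"
    have "card P ^ card I \<le> ?M * b ^ card I"
      by (rule Ncov_join_ge[OF cov inv P I(2,3,1) b])
    then have "real (card P) ^ card I \<le> real ?M * real b ^ card I"
      by (metis of_nat_le_iff of_nat_mult of_nat_power)
    then have le: "(card P / b) ^ card I \<le> real ?M"
      using b1 by (simp add: power_divide divide_le_eq)
    have pos: "0 < card P / b" using b1 by simp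
    have "card I * c = ln ((card P / b) ^ card I)"
      unfolding c_def by (rule ln_realpow[symmetric])
    also have "\<dots> \<le> ln (real ?M)"
    proof -
      have "0 < (card P / b) ^ card I" using pos by (rule zero_less_power)
      with le show ?thesis by (simp add: ln_mono)
    qed
    finally have l: "card I * c \<le> ln (real ?M)" .
    have "real (Suc j * N j) \<le> real ((j + 2) * card I)"
      using I(4) by (simp only: of_nat_le_iff)
    then have "real (Suc j) * real (N j) \<le> real (j + 2) * real (card I)"
      by (simp only: of_nat_mult)
    then have "real (Suc j) / real (j + 2) \<le> real (card I) / real (N j)"
      using that by (simp add: divide_simps mult.commute)
    then have "c * (real (Suc j) / real (j + 2)) \<le> c * (real (card I) / real (N j))"
      using c by (rule mult_left_mono)
    also have "\<dots> \<le> a (N j)"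
      using l that by (simp add: a_def divide_right_mono mult.commute)
    finally show ?thesis .
  qed
  have "(\<lambda>j. c * (real (Suc j) / real (j + 2))) \<longlonglongrightarrow> c * 1"
  proof (rule tendsto_mult[OF tendsto_const])
    have "(\<lambda>j. real (Suc j) / real (Suc (Suc j))) \<longlonglongrightarrow> 1"
      using LIMSEQ_Suc[OF LIMSEQ_n_over_Suc_n] by simp
    then show "(\<lambda>j. real (Suc j) / real (j + 2)) \<longlonglongrightarrow> 1" by simp
  qed
  then have lim: "(\<lambda>j. ereal (c * (real (Suc j) / real (j + 2)))) \<longlonglongrightarrow> ereal c"
    by simp
  have "ereal c = limsup (\<lambda>j. ereal (c * (real (Suc j) / real (j + 2))))"
    by (rule lim_imp_Limsup[OF _ lim, symmetric]) simp
  also have "\<dots> \<le> limsup ((\<lambda>n. ereal (a n)) \<circ> N)"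
  proof (rule Limsup_mono)
    have "eventually (\<lambda>j. N j > 0) sequentially"
      using eventually_gt_at_top[of 0] by eventually_elim (use seq_suble[OF N] in \<open>force intro: less_le_trans\<close>)
    then show "eventually (\<lambda>j. ereal (c * (real (Suc j) / real (j + 2))) \<le> ((\<lambda>n. ereal (a n)) \<circ> N) j) sequentially"
      by eventually_elim (simp only: comp_apply ereal_less_eq(3) bound)
  qed
  also have "\<dots> \<le> limsup (\<lambda>n. ereal (a n))"
    by (rule limsup_subseq_mono[OF N])
  finally have "ereal c \<le> seq_entropy_cover X T A \<U>"
    by (simp add: seq_entropy_cover_def a_def)
  with A that show thesis by (simp add: c_def)
qed

section \<open>Distal systems that are not equicontinuous\<close>

text \<open>Proximality starts at time 1, so time 0 is included by taking the minimum of the infimum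
  and the initial distance.\<close>

lemma distal_sysI:
  assumes sys: "dyn_system X T" and dist: "distal X T"
  shows "distal_sys X T"
proof
  show "compact X" "continuous_on X T" using sys by (auto simp: dyn_system_def)
  show "T x \<in> X" if "x \<in> X" for x using sys that by (auto simp: dyn_system_def)
  fix x y assume xy: "x \<in> X" "y \<in> X" "x \<noteq> y"
  let ?D = "{dist ((T ^^ n) x) ((T ^^ n) y) | n. n \<ge> 1}"
  have bdd: "bdd_below ?D" by (rule bdd_belowI[of _ 0]) auto
  have "0 \<le> Inf ?D" by (rule cInf_greatest) auto
  moreover have "Inf ?D \<noteq> 0" using dist xy by (auto simp: distal_def proximal_def)
  ultimately have "min (Inf ?D) (dist x y) > 0" using xy(3) by simp
  moreover have "min (Inf ?D) (dist x y) \<le> dist ((T ^^ n) x) ((T ^^ n) y)" for n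
  proof (cases "n = 0")
    case False
    then have "Inf ?D \<le> dist ((T ^^ n) x) ((T ^^ n) y)"
      by (intro cInf_lower bdd) auto
    then show ?thesis by simp
  qed simp
  ultimately show "\<exists>\<eta>>0. \<forall>n. \<eta> \<le> dist ((T ^^ n) x) ((T ^^ n) y)" by blast
qed

text \<open>The point at which equicontinuity fails becomes \<open>u 0\<close>, and bad points
  within distance 1/(j+1) of it become the later terms.\<close>

lemma not_equicontinuous_approach:
  assumes "\<not> equicontinuous X T"
  obtains u \<epsilon> where "\<And>m. u m \<in> X" "u \<longlonglongrightarrow> u 0" "\<epsilon> > (0::real)"
    "eventually (\<lambda>m. \<exists>t. \<epsilon> \<le> dist ((T ^^ t) (u m)) ((T ^^ t) (u 0))) sequentially"
proof -
  obtain \<epsilon> x where e: "\<epsilon> > 0" "x \<in> X"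
    and "\<forall>d>0. \<exists>y\<in>X. dist x y < d \<and> (\<exists>n. \<epsilon> \<le> dist ((T ^^ n) x) ((T ^^ n) y))"
    using assms unfolding equicontinuous_def by (metis not_less)
  then have "\<forall>j. \<exists>y. y \<in> X \<and> dist x y < inverse (real (Suc j)) \<and> (\<exists>n. \<epsilon> \<le> dist ((T ^^ n) x) ((T ^^ n) y))"
    by (metis inverse_positive_iff_positive of_nat_0_less_iff zero_less_Suc)
  from choice[OF this] obtain y where y: "\<And>j. y j \<in> X" "\<And>j. dist x (y j) < inverse (real (Suc j))"
    "\<And>j. \<exists>n. \<epsilon> \<le> dist ((T ^^ n) x) ((T ^^ n) (y j))" by blast
  define u where "u m = (case m of 0 \<Rightarrow> x | Suc j \<Rightarrow> y j)" for m
  show thesis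
  proof (rule that[of u \<epsilon>])
    show "u m \<in> X" for m using e y by (auto simp: u_def split: nat.split)
    have "(\<lambda>j. dist (y j) x) \<longlonglongrightarrow> 0"
    proof (rule tendsto_sandwich[OF _ _ tendsto_const LIMSEQ_inverse_real_of_nat])
      show "eventually (\<lambda>j. dist (y j) x \<le> inverse (real (Suc j))) sequentially"
        using y(2) by (intro always_eventually allI) (simp add: dist_commute less_imp_le)
    qed simp
    then have "(\<lambda>j. u (Suc j)) \<longlonglongrightarrow> u 0"
      by (simp add: u_def tendsto_dist_iff[of y])
    then show "u \<longlonglongrightarrow> u 0" by (rule LIMSEQ_imp_Suc)
    have "\<exists>t. \<epsilon> \<le> dist ((T ^^ t) (u m)) ((T ^^ t) (u 0))" if "m > 0" for m
      using y(3) that by (cases m) (auto simp: u_def dist_commute)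
    then show "eventually (\<lambda>m. \<exists>t. \<epsilon> \<le> dist ((T ^^ t) (u m)) ((T ^^ t) (u 0))) sequentially"
      by (rule eventually_mono[OF eventually_gt_at_top[of 0]])
  qed (rule e)
qed

text \<open>The order of quantifiers is essential: the same \<open>n\<close> points serve every
  radius and every length.\<close>

lemma distal_independent_points:
  assumes "dyn_system X T" "distal X T" "\<not> equicontinuous X T" and n: "n \<ge> 2"
  obtains P where "finite P" "card P = n" "P \<subseteq> X"
    "\<And>e k. e > 0 \<Longrightarrow> \<exists>I. finite I \<and> card I = k \<and> indep X T P e I"
proof -
  interpret distal_sys X T using assms(1,2) by (rule distal_sysI)
  obtain u \<epsilon> where u: "\<And>m. u m \<in> X" "u \<longlonglongrightarrow> u 0" "\<epsilon> > (0::real)"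
    "eventually (\<lambda>m. \<exists>t. \<epsilon> \<le> dist ((T ^^ t) (u m)) ((T ^^ t) (u 0))) sequentially"
    by (rule not_equicontinuous_approach[OF assms(3)]) (rule that)
  obtain U :: "nat filter" where U: "U \<le> sequentially" "ultra U"
    by (rule ultra_exists[OF sequentially_bot])
  interpret distal_approach X T u U \<epsilon>
    by unfold_locales (use u U in auto)
  obtain P where P: "finite P" "card P = n" "P \<subseteq> X"
    and sh: "\<And>e k. e > 0 \<Longrightarrow> \<exists>w. (\<forall>i<k. w i \<in> X) \<and>
       (\<forall>\<sigma>\<in>{..<k::nat} \<rightarrow>\<^sub>E P. \<exists>t. \<forall>i<k. dist (\<sigma> i) ((T ^^ t) (w i)) < e)"
    by (rule shatter_limit) (rule that)
  show thesis
    by (rule that[OF P indep_of_shatter[OF P(1) _ _ sh]]) (use P n in auto)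
qed

text \<open>By admissibility each member of the cover keeps away from some coordinate. For
  \<open>e\<close> below these finitely many distances it is close to at most n-1 of the n
  coordinates, which gives entropy at least ln(n/(n-1)) > 0.\<close>

lemma independent_points_seq_entropy_tuple:
  assumes sys: "dyn_system X T" and P: "set xs \<subseteq> X" "distinct xs" "length xs \<ge> 2"
    and ind: "\<And>e k. e > 0 \<Longrightarrow> \<exists>I. finite I \<and> card I = k \<and> indep X T (set xs) e I"
  shows "seq_entropy_tuple X T xs"
proof -
  have inv: "T ` X \<subseteq> X" using sys by (simp add: dyn_system_def)
  have "xs ! 0 \<noteq> xs ! 1" using P nth_eq_iff_index_eq[of xs 0 1] by force
  then have "\<exists>i<length xs. \<exists>j<length xs. xs ! i \<noteq> xs ! j"
    using P(3) by (intro exI[of _ 0] conjI exI[of _ 1]) auto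
  moreover have "\<exists>A. strict_mono A \<and> seq_entropy_cover X T A \<U> > 0"
    if cov: "open_cover X \<U>" and adm: "admissible X \<U> xs" for \<U>
  proof -
    have "\<forall>V\<in>\<U>. \<exists>e>0. \<exists>p\<in>set xs. \<forall>x\<in>V. e \<le> dist p x"
    proof
      fix V assume "V \<in> \<U>"
      then obtain i where i: "i < length xs" "xs ! i \<notin> closure V"
        using adm by (auto simp: admissible_def)
      then obtain e where "e > 0" "\<forall>x\<in>V. e \<le> dist (xs ! i) x"
        unfolding closure_approachable by (auto simp: not_less dist_commute)
      then show "\<exists>e>0. \<exists>p\<in>set xs. \<forall>x\<in>V. e \<le> dist p x" using i(1) nth_mem by blast
    qed
    from bchoice[OF this] obtain d where
      d: "\<And>V. V \<in> \<U> \<Longrightarrow> d V > 0" "\<And>V. V \<in> \<U> \<Longrightarrow> \<exists>p\<in>set xs. \<forall>x\<in>V. d V \<le> dist p x" by blast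
    have fin: "finite \<U>" using cov by (simp add: open_cover_def)
    define e where "e = Min (insert 1 (d ` \<U>))"
    have e: "e > 0" "\<And>V. V \<in> \<U> \<Longrightarrow> e \<le> d V" using fin d(1) by (auto simp: e_def)
    have b: "card {p\<in>set xs. \<exists>x\<in>V. dist p x < e} \<le> length xs - 1" if V: "V \<in> \<U>" for V
    proof -
      obtain p where p: "p \<in> set xs" "\<forall>x\<in>V. d V \<le> dist p x" using d(2)[OF V] by blast
      have "{p\<in>set xs. \<exists>x\<in>V. dist p x < e} \<subseteq> set xs - {p}"
        using p(2) e(2)[OF V] by fastforce
      then have "card {p\<in>set xs. \<exists>x\<in>V. dist p x < e} \<le> card (set xs - {p})"
        by (intro card_mono) auto
      also have "\<dots> = length xs - 1" using p(1) P(2) by (simp add: distinct_card)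
      finally show ?thesis .
    qed
    have card: "card (set xs) = length xs" using P(2) by (rule distinct_card)
    obtain A where A: "strict_mono A"
      "ereal (ln (card (set xs) / real (length xs - 1))) \<le> seq_entropy_cover X T A \<U>"
      by (rule seq_entropy_cover_ge[OF cov inv _ ind[OF e(1)] b]) (use P(3) card in auto)
    have "1 < length xs / real (length xs - 1)" using P(3) by simp
    then have "0 < ereal (ln (card (set xs) / real (length xs - 1)))" by (simp add: card)
    with A show ?thesis by (meson less_le_trans)
  qed
  ultimately show ?thesis using P by (simp add: seq_entropy_tuple_def)
qed

text \<open>For a cover whose members are each \<open>e\<close>-close to at most one point of
  \<open>P\<close>, the counting bound has \<open>b = 1\<close> and yields the full
  logarithm.\<close>

lemma independent_points_seq_entropy:
  assumes sys: "dyn_system X T" and P: "finite P" "P \<noteq> {}"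
    and ind: "\<And>e k. e > 0 \<Longrightarrow> \<exists>I. finite I \<and> card I = k \<and> indep X T P e I"
  shows "\<exists>A. strict_mono A \<and> ereal (ln (card P)) \<le> seq_entropy X T A"
proof -
  have inv: "T ` X \<subseteq> X" using sys by (simp add: dyn_system_def)
  let ?D = "insert 1 ((\<lambda>(p, q). dist p q) ` {(p, q). p \<in> P \<and> q \<in> P \<and> p \<noteq> q})"
  have "finite {(p, q). p \<in> P \<and> q \<in> P \<and> p \<noteq> q}"
    by (rule finite_subset[OF _ finite_cartesian_product[OF P(1) P(1)]]) auto
  then have finD: "finite ?D" by simp
  \<comment> \<open>A third of the least distance makes the closed \<open>e\<close>-balls disjoint;
    the \<open>1\<close> in \<open>?D\<close> covers a one-point \<open>P\<close>.\<close>
  define e where "e = Min ?D / 3"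
  have e: "e > 0" using finD by (auto simp: e_def)
  have sep: "2 * e < dist p q" if "p \<in> P" "q \<in> P" "p \<noteq> q" for p q
  proof -
    have "Min ?D \<le> dist p q" by (rule Min_le[OF finD]) (use that in auto)
    with e show ?thesis by (simp add: e_def)
  qed
  \<comment> \<open>Only the balls about the other points are removed. As a point of
    \<open>X\<close> lies in at most one ball, these sets still cover \<open>X\<close>.\<close>
  define V where "V p = X - (\<Union>q\<in>P - {p}. cball q e)" for p
  have cov: "open_cover X (V ` P)"
    unfolding open_cover_def
  proof (intro conjI ballI subsetI)
    show "finite (V ` P)" using P by simp
    show "openin (top_of_set X) W" if "W \<in> V ` P" for W
    proof -
      from that obtain p where "W = V p" by blast
      then have "W = X \<inter> - (\<Union>q\<in>P - {p}. cball q e)" by (simp only: V_def Diff_eq)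
      moreover have "open (- (\<Union>q\<in>P - {p}. cball q e))"
        using P(1) by (intro open_Compl closed_UN) auto
      ultimately show ?thesis by (simp add: openin_open_Int)
    qed
    fix x assume x: "x \<in> X"
    show "x \<in> \<Union>(V ` P)"
    proof (cases "\<exists>p\<in>P. x \<in> cball p e")
      case True
      then obtain p where p: "p \<in> P" "dist p x \<le> e" by auto
      have "\<not> dist q x \<le> e" if "q \<in> P - {p}" for q
        using sep[of p q] that p dist_triangle2[of p q x] by auto
      with p x show ?thesis by (auto simp: V_def)
    next
      case False
      with x P(2) show ?thesis by (auto simp: V_def)
    qed
  qed
  have b: "card {r\<in>P. \<exists>x\<in>W. dist r x < e} \<le> 1" if W: "W \<in> V ` P" for W
  proof -
    obtain p where "W = V p" using W by blast
    then have "{r\<in>P. \<exists>x\<in>W. dist r x < e} \<subseteq> {p}" by (auto simp: V_def)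
    then have "card {r\<in>P. \<exists>x\<in>W. dist r x < e} \<le> card {p}" by (rule card_mono[rotated]) simp
    then show ?thesis by simp
  qed
  have "card P \<ge> 1" using P by (simp add: Suc_leI card_gt_0_iff)
  then obtain A where A: "strict_mono A" "ereal (ln (card P / real 1)) \<le> seq_entropy_cover X T A (V ` P)"
    using seq_entropy_cover_ge[OF cov inv P(1) ind[OF e] b] by blast
  moreover have "seq_entropy_cover X T A (V ` P) \<le> seq_entropy X T A"
    unfolding seq_entropy_def by (rule SUP_upper) (simp add: cov)
  ultimately show ?thesis by (intro exI[of _ A]) auto
qed

theorem mainTheorem6:
  fixes X :: "'a::metric_space set" and T :: "'a \<Rightarrow> 'a"
  assumes "dyn_system X T" and "distal X T" and "\<not> equicontinuous X T"
  shows "(\<forall>n\<ge>2. SE_e X T n \<noteq> {}) \<and>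
         (SUP A\<in>{A::nat\<Rightarrow>nat. strict_mono A}. seq_entropy X T A) = \<infinity>"
proof
  show "\<forall>n\<ge>2. SE_e X T n \<noteq> {}"
  proof (intro allI impI)
    fix n :: nat assume n: "n \<ge> 2"
    obtain P where P: "finite P" "card P = n" "P \<subseteq> X"
      and ind: "\<And>e k. e > 0 \<Longrightarrow> \<exists>I. finite I \<and> card I = k \<and> indep X T P e I"
      by (rule distal_independent_points[OF assms n]) (rule that)
    obtain xs where xs: "set xs = P" "distinct xs"
      using finite_distinct_list[OF P(1)] by blast
    then have len: "length xs = n" using P(2) distinct_card by force
    have "seq_entropy_tuple X T xs"
      by (rule independent_points_seq_entropy_tuple[OF assms(1)]) (use xs P n len ind in auto)
    with xs len show "SE_e X T n \<noteq> {}" by (auto simp: SE_e_def)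
  qed
  show "(SUP A\<in>{A::nat\<Rightarrow>nat. strict_mono A}. seq_entropy X T A) = \<infinity>"
  proof (rule ereal_top)
    fix B :: real
    \<comment> \<open>With \<open>n\<close> at least \<open>exp B\<close>, the entropy bound
      \<open>ln n\<close> reaches \<open>B\<close>.\<close>
    obtain m :: nat where m: "exp B \<le> m" using real_arch_simple by blast
    define n where "n = max 2 m"
    have n: "n \<ge> 2" "exp B \<le> n" using m by (auto simp: n_def)
    obtain P where P: "finite P" "card P = n" "P \<subseteq> X"
      and ind: "\<And>e k. e > 0 \<Longrightarrow> \<exists>I. finite I \<and> card I = k \<and> indep X T P e I"
      by (rule distal_independent_points[OF assms n(1)]) (rule that)
    obtain A where A: "strict_mono A" "ereal (ln (card P)) \<le> seq_entropy X T A"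
      using independent_points_seq_entropy[OF assms(1) P(1) _ ind] P n by force
    have "B \<le> ln (card P)" using n P(2) by (simp add: ln_ge_iff)
    then have "ereal B \<le> ereal (ln (card P))" by simp
    also note A(2)
    also have "seq_entropy X T A \<le> (SUP A\<in>{A::nat\<Rightarrow>nat. strict_mono A}. seq_entropy X T A)"
      using A(1) by (intro SUP_upper) simp
    finally show "ereal B \<le> (SUP A\<in>{A::nat\<Rightarrow>nat. strict_mono A}. seq_entropy X T A)" .
  qed
qed

end
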